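(* Let $N\ge 3$, $\beta\in(0,1)\cup(1,\infty)$, and let $\xi(t)=(\xi_1(t),\dots,\xi_{N+1}(t))$, $t\in\mathbb{Z}_+$, be the growth process with neighbourhoods $U_i=\{i-1,i,i+1\}$, $i=1,\dots,N+1$ (symmetric interaction, indices modulo $N+1$), and let $\zeta(t)=(\zeta_1(t),\dots,\zeta_N(t))$, $\zeta_i(t)=\xi_i(t)-\xi_{N+1}(t)$, be its process of differences. Then the Markov chain $(\zeta(t),\,t\in\mathbb{Z}_+)$ is transient. Moreover, if $\beta>1$, then with probability $1$ there is a $k\in\{1,\dots,N+1\}$ such that $$\lim_{t\to\infty}\xi_i(t)=\infty\ \text{ if and only if }\ i\in\{k-1,k\},\qquad\text{and}\qquad \lim_{t\to\infty}\frac{\xi_k(t)}{\xi_{k-1}(t)}=\beta^{c},$$ where $c=\lim_{t\to\infty}[\xi_{k+1}(t)-\xi_{k-2}(t)]\in\mathbb{Z}$ (indices modulo $N+1$).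
   Context: $\mathbb{Z}_+=\{0,1,2,\dots\}$. The sites are $1,2,\dots,N+1$, arranged as a one-dimensional lattice torus (periodic boundary conditions), so site indices are understood modulo $N+1$; e.g. $U_1=\{N+1,1,2\}$ and $U_{N+1}=\{N,N+1,1\}$. The growth process is the discrete-time Markov chain $\xi(t)$ on $\mathbb{Z}_+^{N+1}$ with transition probabilities $$\mathbb{P}\{\xi_i(t+1)=\xi_i(t)+1,\ \xi_j(t+1)=\xi_j(t)\ \forall j\neq i\mid \xi(t)\}=\frac{\beta^{u_i(t)}}{\sum_{j=1}^{N+1}\beta^{u_j(t)}},\qquad u_i(t)=\sum_{j\in U_i}\xi_j(t),\quad i=1,\dots,N+1.$$ The process of differences $\zeta(t)\in\mathbb{Z}^N$, $\zeta_i(t)=\xi_i(t)-\xi_{N+1}(t)$, $i=1,\dots,N$ (with the convention $\zeta_{N+1}(t)\equiv 0$), is itself a time-homogeneous Markov chain on $\mathbb{Z}^N$: for $k=1,\dots,N$ it moves from $\zeta(t)$ to $\zeta(t)+e_k$ ($e_k$ the $k$-th unit vector) with probability proportional to $\beta^{\sum_{j\in U_k}\zeta_j(t)}$, and to $\zeta(t)-(1,\dots,1)$ with probability proportional to $\beta^{\sum_{j\in U_{N+1}}\zeta_j(t)}$. "Transient" means that $\lim_{t\to\infty}|\zeta(t)|=\infty$ almost surely, where $|\cdot|$ is the Euclidean norm. *)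

theory Defs
  imports "HOL-Probability.Probability"
begin

text \<open>
  The lattice torus has sites \<open>1, \<dots>, N + 1\<close>; arithmetic on site indices is modulo \<open>N + 1\<close>
  with representatives in \<open>{1..N + 1}\<close>.
\<close>

definition next_site :: "nat \<Rightarrow> nat \<Rightarrow> nat" where
  "next_site N i = (if i = N + 1 then 1 else i + 1)"

definition prev_site :: "nat \<Rightarrow> nat \<Rightarrow> nat" where
  "prev_site N i = (if i = 1 then N + 1 else i - 1)"

definition neighbourhood :: "nat \<Rightarrow> nat \<Rightarrow> nat set" where
  "neighbourhood N i = {prev_site N i, i, next_site N i}"

definition potential :: "nat \<Rightarrow> (nat \<Rightarrow> nat) \<Rightarrow> nat \<Rightarrow> nat" where
  "potential N x i = (\<Sum>j\<in>neighbourhood N i. x j)"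

text \<open>
  A configuration in \<open>\<int>\<^sub>+\<^bsup>N+1\<^esup>\<close> is a function in \<open>{1..N + 1} \<rightarrow>\<^sub>E UNIV\<close>, so the state space is
  countable. The conditioning on the whole history, over all histories of positive probability,
  expresses both the Markov property and the one-step transition probabilities; the
  probabilities given for the \<open>N + 1\<close> possible steps sum to 1, so no other step occurs.
  The law of the initial state is arbitrary.
\<close>

locale growth_process = prob_space M for M :: "'w measure" +
  fixes N :: nat and \<beta> :: real and \<xi> :: "nat \<Rightarrow> 'w \<Rightarrow> nat \<Rightarrow> nat"
  assumes state_measurable:
    "\<And>t. \<xi> t \<in> M \<rightarrow>\<^sub>M count_space ({1..N + 1} \<rightarrow>\<^sub>E UNIV)"
  and transition:
    "\<And>t x i. i \<in> {1..N + 1} \<Longrightarrow> \<P>(\<omega> in M. \<forall>s\<le>t. \<xi> s \<omega> = x s) > 0 \<Longrightarrow>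
      \<P>(\<omega> in M. \<xi> (t + 1) \<omega> = (\<xi> t \<omega>)(i := \<xi> t \<omega> i + 1) \<bar> \<forall>s\<le>t. \<xi> s \<omega> = x s)
        = \<beta> ^ potential N (x t) i / (\<Sum>j=1..N + 1. \<beta> ^ potential N (x t) j)"

definition differences :: "nat \<Rightarrow> (nat \<Rightarrow> nat) \<Rightarrow> nat \<Rightarrow> int" where
  "differences N x = (\<lambda>i\<in>{1..N}. int (x i) - int (x (N + 1)))"

definition transient :: "'w measure \<Rightarrow> nat \<Rightarrow> (nat \<Rightarrow> 'w \<Rightarrow> nat \<Rightarrow> int) \<Rightarrow> bool" where
  "transient M N \<zeta> \<longleftrightarrow>
    (AE \<omega> in M. filterlim (\<lambda>t. L2_set (\<lambda>i. real_of_int (\<zeta> t \<omega> i)) {1..N}) at_top sequentially)"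

end

theory Submission
  imports Defs
begin

text \<open>
  For \<open>\<beta> > 1\<close>, let \<open>i\<close> maximise the potential and let \<open>j\<close> be the neighbour of \<open>i\<close> with the larger
  potential. When only \<open>i\<close> and \<open>j\<close> grow, \<open>m\<close> and \<open>n\<close> times respectively, the weight of the other
  neighbour of \<open>i\<close> is at most \<open>\<beta>\<^sup>-\<^sup>n\<close> times that of \<open>j\<close>, and every other weight is at most \<open>\<beta>\<^sup>-\<^sup>m\<close>
  times that of \<open>i\<close>. A product subsolution in \<open>m\<close> and \<open>n\<close> bounds the probability of staying
  in this pair forever below by a constant that does not depend on the configuration, so the
  growth is eventually confined to a pair. There the two weights have the constant ratio
  \<open>\<beta>\<^sup>c\<close>, and a Chernoff bound gives the law of large numbers.

  For \<open>\<beta> < 1\<close>, let \<open>Q\<close> be the quadratic form \<open>\<Sum>\<^sub>i x\<^sub>i u\<^sub>i\<close> corrected by a multiple of \<open>(\<Sum>\<^sub>i x\<^sub>i)\<^sup>2\<close> so that it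
  is a function of the differences. It takes arbitrarily negative values since \<open>N \<ge> 3\<close>, and
  \<open>\<beta> powr (- Q / 2)\<close> is superharmonic where \<open>Q\<close> is very negative. Hence from every state the
  differences reach, with positive probability, a region from which they never return.
\<close>

section \<open>The process killed outside a set of configurations\<close>

definition inc :: "(nat \<Rightarrow> nat) \<Rightarrow> nat \<Rightarrow> nat \<Rightarrow> nat" where
  "inc x i = x(i := x i + 1)"

definition sites :: "nat \<Rightarrow> nat set" where
  "sites N = {1..N + 1}"

lemma finite_sites [simp]: "finite (sites N)"
  and sites_nonempty [simp]: "sites N \<noteq> {}"
  and card_sites [simp]: "card (sites N) = N + 1"
  by (auto simp: sites_def)

definition step_prob :: "nat \<Rightarrow> real \<Rightarrow> (nat \<Rightarrow> nat) \<Rightarrow> nat \<Rightarrow> real" where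
  "step_prob N \<beta> x i = \<beta> ^ potential N x i / (\<Sum>j\<in>sites N. \<beta> ^ potential N x j)"

text \<open>Membership in \<open>S\<close> is tested after the step and not at \<open>x\<close>, so
  the start may lie outside \<open>S\<close>. Iterating on the constant 1 gives the probability that
  the next \<open>n\<close> configurations all lie in \<open>S\<close>.\<close>

definition killed :: "nat \<Rightarrow> real \<Rightarrow> (nat \<Rightarrow> nat) set \<Rightarrow> ((nat \<Rightarrow> nat) \<Rightarrow> real) \<Rightarrow> (nat \<Rightarrow> nat) \<Rightarrow> real" where
  "killed N \<beta> S f x = (\<Sum>i\<in>sites N. step_prob N \<beta> x i * (indicator S (inc x i) * f (inc x i)))"

lemma inc_inj: "inc x i = inc x j \<longleftrightarrow> i = j"
  by (auto simp: inc_def fun_eq_iff split: if_splits)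

lemma weight_sum_pos:
  assumes "\<beta> > 0" shows "(\<Sum>j\<in>sites N. \<beta> ^ f j) > (0::real)"
  using assms by (intro sum_pos) auto

lemma step_prob_pos: "\<beta> > 0 \<Longrightarrow> step_prob N \<beta> x i > 0"
  unfolding step_prob_def by (intro divide_pos_pos weight_sum_pos) auto

lemma sum_step_prob: "\<beta> > 0 \<Longrightarrow> (\<Sum>i\<in>sites N. step_prob N \<beta> x i) = 1"
  using weight_sum_pos[of \<beta> "potential N x" N]
  by (simp add: step_prob_def sum_divide_distrib[symmetric])

lemma killed_mono:
  assumes "\<beta> > 0" and "\<And>i. i \<in> sites N \<Longrightarrow> inc x i \<in> S \<Longrightarrow> f (inc x i) \<le> g (inc x i)"
  shows "killed N \<beta> S f x \<le> killed N \<beta> S g x"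
  unfolding killed_def using assms
  by (intro sum_mono mult_left_mono[OF _ less_imp_le[OF step_prob_pos]]) (auto split: split_indicator)

lemma killed_funpow_mono:
  assumes "\<beta> > 0" "\<And>y. f y \<le> g y"
  shows "(killed N \<beta> S ^^ n) f x \<le> (killed N \<beta> S ^^ n) g x"
  using assms(2) by (induction n arbitrary: x) (auto intro!: killed_mono assms(1))

lemma killed_funpow_nonneg:
  assumes "\<beta> > 0" "\<And>y. 0 \<le> f y"
  shows "0 \<le> (killed N \<beta> S ^^ n) f x"
proof (induction n arbitrary: x)
  case (Suc n)
  then show ?case
    unfolding funpow.simps o_def killed_def
    by (intro sum_nonneg mult_nonneg_nonneg) (auto simp: less_imp_le step_prob_pos[OF assms(1)])
qed (use assms in auto)

text \<open>Comparison principle by induction on \<open>n\<close>: monotonicity of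
  \<open>killed\<close> carries the bound by 1 through all iterates. The result does not depend on
  \<open>n\<close>, so it also bounds the probability of staying in \<open>S\<close>
  forever.\<close>

lemma subsolution_le_stay:
  assumes "\<beta> > 0" "\<And>y. y \<in> S \<Longrightarrow> h y \<le> killed N \<beta> S h y" "\<And>y. y \<in> S \<Longrightarrow> h y \<le> 1" "x \<in> S"
  shows "h x \<le> (killed N \<beta> S ^^ n) (\<lambda>_. 1) x"
  using assms(4)
proof (induction n arbitrary: x)
  case (Suc n)
  have "h x \<le> killed N \<beta> S h x" using assms Suc by blast
  also have "\<dots> \<le> killed N \<beta> S ((killed N \<beta> S ^^ n) (\<lambda>_. 1)) x"
    by (intro killed_mono assms(1) Suc)
  finally show ?case by simp
qed (use assms in auto)

text \<open>Only the first step at site \<open>i\<close> is kept, and \<open>x\<close> itself may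
  lie outside \<open>S\<close>. For \<open>n = 0\<close> there is no step, and the claim reduces to
  \<delta> and \<epsilon> being at most 1.\<close>

lemma stay_step:
  assumes "\<beta> > 0" "i \<in> sites N" "inc x i \<in> S" "\<epsilon> \<ge> 0" "\<epsilon> \<le> 1" "\<delta> \<le> step_prob N \<beta> x i" "\<delta> \<ge> 0"
    "\<And>n. \<epsilon> \<le> (killed N \<beta> S ^^ n) (\<lambda>_. 1) (inc x i)"
  shows "\<delta> * \<epsilon> \<le> (killed N \<beta> S ^^ n) (\<lambda>_. 1) x"
proof (cases n)
  case 0
  have "step_prob N \<beta> x i \<le> (\<Sum>i\<in>sites N. step_prob N \<beta> x i)"
    using assms by (intro member_le_sum) (auto simp: less_imp_le step_prob_pos)
  then have "\<delta> \<le> 1" using sum_step_prob assms by fastforce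
  then show ?thesis using 0 assms mult_mono[of \<delta> 1 \<epsilon> 1] by simp
next
  case (Suc m)
  let ?f = "\<lambda>i. step_prob N \<beta> x i * (indicator S (inc x i) * (killed N \<beta> S ^^ m) (\<lambda>_. 1) (inc x i))"
  have "\<delta> * \<epsilon> \<le> ?f i"
    using assms(3-) step_prob_pos[OF assms(1), of N x i] by (auto intro!: mult_mono)
  also have "\<dots> \<le> sum ?f (sites N)"
    using assms(1,2)
    by (intro member_le_sum mult_nonneg_nonneg) (auto intro!: killed_funpow_nonneg simp: less_imp_le step_prob_pos)
  finally show ?thesis by (simp add: Suc killed_def)
qed

section \<open>Path probabilities of the process in terms of the killed operator\<close>

context growth_process
begin

lemma pred_state [measurable]: "Measurable.pred M (\<lambda>\<omega>. P (\<xi> t \<omega>))"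
  by (rule measurable_compose[OF state_measurable]) simp

lemma state_in: "\<omega> \<in> space M \<Longrightarrow> \<xi> t \<omega> \<in> sites N \<rightarrow>\<^sub>E UNIV"
  using measurable_space[OF state_measurable] by (simp add: sites_def)

definition past :: "nat \<Rightarrow> (nat \<Rightarrow> nat \<Rightarrow> nat) \<Rightarrow> 'w set" where
  "past t x = {\<omega> \<in> space M. \<forall>s\<le>t. \<xi> s \<omega> = x s}"

lemma past_sets [measurable]: "past t x \<in> sets M"
  unfolding past_def by measurable

lemma past_Suc_eq:
  "past (Suc t) (x(Suc t := y)) = past t x \<inter> {\<omega>\<in>space M. \<xi> (Suc t) \<omega> = y}"
  unfolding past_def by (auto simp: le_Suc_eq)

text \<open>Product form of the transition law. For a null past both sides vanish, so later
  arguments never have to divide by its probability.\<close>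

lemma prob_past_Suc:
  assumes "i \<in> sites N"
  shows "prob (past (Suc t) (x(Suc t := inc (x t) i))) = prob (past t x) * step_prob N \<beta> (x t) i"
proof (cases "prob (past t x) > 0")
  case True
  have eq: "{\<omega> \<in> space M. \<xi> (t + 1) \<omega> = (\<xi> t \<omega>)(i := \<xi> t \<omega> i + 1) \<and> (\<forall>s\<le>t. \<xi> s \<omega> = x s)}
      = past (Suc t) (x(Suc t := inc (x t) i))"
    unfolding past_Suc_eq by (auto simp: past_def inc_def)
  show ?thesis
    using transition[OF assms[unfolded sites_def], of t x] True
    unfolding cond_prob_def eq step_prob_def sites_def past_def[symmetric] by (simp add: field_simps)
next
  case False
  then have "prob (past t x) = 0" using measure_nonneg[of M "past t x"] by linarith
  moreover have "prob (past (Suc t) (x(Suc t := inc (x t) i))) \<le> prob (past t x)"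
    unfolding past_Suc_eq by (intro finite_measure_mono) auto
  ultimately show ?thesis using measure_nonneg[of M "past (Suc t) (x(Suc t := inc (x t) i))"] by simp
qed

lemma prob_split_step:
  assumes "\<beta> > 0" and E: "E \<in> sets M" and "E \<subseteq> past t x"
  shows "prob E = (\<Sum>i\<in>sites N. prob (E \<inter> {\<omega>\<in>space M. \<xi> (Suc t) \<omega> = inc (x t) i}))"
proof -
  define B where "B i = {\<omega>\<in>space M. \<xi> (Suc t) \<omega> = inc (x t) i}" for i
  have B: "B i \<in> sets M" for i unfolding B_def by measurable
  have UB: "(\<Union>i\<in>sites N. B i) \<in> sets M" using B by blast
  have sum: "prob (E \<inter> (\<Union>i\<in>sites N. B i)) = (\<Sum>i\<in>sites N. prob (E \<inter> B i))"
    if E: "E \<in> sets M" for E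
  proof -
    have "E \<inter> (\<Union>i\<in>sites N. B i) = (\<Union>i\<in>sites N. E \<inter> B i)" by blast
    moreover have "disjoint_family_on (\<lambda>i. E \<inter> B i) (sites N)"
      unfolding disjoint_family_on_def B_def by (auto simp: inc_inj)
    moreover have "(\<lambda>i. E \<inter> B i) ` sites N \<subseteq> sets M" using E B by blast
    ultimately show ?thesis using finite_measure_finite_Union[OF finite_sites] by metis
  qed
  have "prob (past t x \<inter> (\<Union>i\<in>sites N. B i)) = (\<Sum>i\<in>sites N. prob (past t x) * step_prob N \<beta> (x t) i)"
    unfolding sum[OF past_sets] unfolding B_def past_Suc_eq[symmetric]
    by (intro sum.cong refl prob_past_Suc)
  also have "\<dots> = prob (past t x) * (\<Sum>i\<in>sites N. step_prob N \<beta> (x t) i)"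
    by (rule sum_distrib_left[symmetric])
  also have "\<dots> = prob (past t x)"
    using sum_step_prob[OF assms(1)] by simp
  finally have 0: "prob (past t x - (\<Union>i\<in>sites N. B i)) = 0"
    using finite_measure_Diff'[OF past_sets UB] by simp
  have "prob (E - (\<Union>i\<in>sites N. B i)) \<le> prob (past t x - (\<Union>i\<in>sites N. B i))"
    using assms(3) UB by (intro finite_measure_mono Diff_mono sets.Diff past_sets) auto
  then have "prob (E - (\<Union>i\<in>sites N. B i)) = 0"
    using 0 measure_nonneg[of M "E - (\<Union>i\<in>sites N. B i)"] by linarith
  then have "prob E = prob (E \<inter> (\<Union>i\<in>sites N. B i))"
    using finite_measure_Diff'[OF E UB] by simp
  then show ?thesis unfolding sum[OF E] unfolding B_def .
qed

text \<open>Markov property by induction on the number of steps: splitting on the first step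
  reproduces the outer \<open>killed\<close>. Time and history are generalised because the
  hypothesis is applied at \<open>Suc t\<close> to the extended history.\<close>

lemma prob_killed_path:
  assumes "\<beta> > 0"
  shows "prob {\<omega>\<in>past t x. (\<forall>s\<in>{t<..t+n}. \<xi> s \<omega> \<in> S) \<and> \<xi> (t+n) \<omega> \<in> F}
    = prob (past t x) * (killed N \<beta> S ^^ n) (indicator F) (x t)"
proof (induction n arbitrary: t x)
  case 0
  have "{\<omega>\<in>past t x. (\<forall>s\<in>{t<..t+0}. \<xi> s \<omega> \<in> S) \<and> \<xi> (t+0) \<omega> \<in> F} = (if x t \<in> F then past t x else {})"
    by (auto simp: past_def)
  then show ?case by auto
next
  case (Suc n)
  let ?E = "{\<omega>\<in>past t x. (\<forall>s\<in>{t<..t+Suc n}. \<xi> s \<omega> \<in> S) \<and> \<xi> (t+Suc n) \<omega> \<in> F}"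
  have 1: "prob (?E \<inter> {\<omega>\<in>space M. \<xi> (Suc t) \<omega> = inc (x t) i}) =
     prob (past t x) * (step_prob N \<beta> (x t) i * (indicator S (inc (x t) i) *
        (killed N \<beta> S ^^ n) (indicator F) (inc (x t) i)))" if i: "i \<in> sites N" for i
  proof -
    define y where "y = x(Suc t := inc (x t) i)"
    have y: "y (Suc t) = inc (x t) i" by (simp add: y_def)
    have "?E \<inter> {\<omega>\<in>space M. \<xi> (Suc t) \<omega> = inc (x t) i} =
      (if inc (x t) i \<in> S then {\<omega>\<in>past (Suc t) y. (\<forall>s\<in>{Suc t<..Suc t+n}. \<xi> s \<omega> \<in> S) \<and> \<xi> (Suc t+n) \<omega> \<in> F} else {})"
    proof -
      have "{t<..t + Suc n} = insert (Suc t) {Suc t<..Suc t+n}" by auto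
      then show ?thesis
        unfolding y_def past_Suc_eq by (cases "inc (x t) i \<in> S") auto
    qed
    then show ?thesis
      using Suc[of "Suc t" y] prob_past_Suc[OF i, of t x, folded y_def]
      by (cases "inc (x t) i \<in> S")
        (simp_all only: y if_True if_False indicator_simps measure_empty mult_zero_left mult_zero_right
          mult_1 mult.assoc not_False_eq_True)
  qed
  have "prob ?E = (\<Sum>i\<in>sites N. prob (?E \<inter> {\<omega>\<in>space M. \<xi> (Suc t) \<omega> = inc (x t) i}))"
  proof (rule prob_split_step[OF assms])
    show "?E \<in> sets M" by measurable
    show "?E \<subseteq> past t x" by blast
  qed
  then show ?case
    by (simp only: 1 funpow.simps o_apply killed_def[of N \<beta> S "(killed N \<beta> S ^^ n) (indicator F)"]
        sum_distrib_left cong: sum.cong)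
qed

text \<open>Extensional prefixes form a countable set and give disjoint events, so statements proved
  for each fixed past combine to almost sure ones.\<close>

definition histories :: "nat \<Rightarrow> (nat \<Rightarrow> nat \<Rightarrow> nat) set" where
  "histories t = {..t} \<rightarrow>\<^sub>E (sites N \<rightarrow>\<^sub>E UNIV)"

lemma countable_histories: "countable (histories t)"
  unfolding histories_def by (intro countable_PiE) auto

lemma history_in: "\<omega> \<in> space M \<Longrightarrow> restrict (\<lambda>s. \<xi> s \<omega>) {..t} \<in> histories t"
  using state_in by (auto simp: histories_def)

lemma past_history: "\<omega> \<in> space M \<Longrightarrow> \<omega> \<in> past t (restrict (\<lambda>s. \<xi> s \<omega>) {..t})"
  by (auto simp: past_def)

lemma disjoint_past: "disjoint_family_on (past t) (histories t)"
proof (unfold disjoint_family_on_def, intro ballI impI)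
  fix x y assume xy: "x \<in> histories t" "y \<in> histories t" "x \<noteq> y"
  have "x = y" if "\<omega> \<in> past t x \<inter> past t y" for \<omega>
    using xy(1,2) that unfolding histories_def past_def by (auto intro: PiE_ext[of x "{..t}" _ y])
  with xy(3) show "past t x \<inter> past t y = {}" by blast
qed

text \<open>Inside a fixed past the exceptional event misses every step event and is null by
  \<open>prob_split_step\<close>; countability of \<open>histories\<close> joins the pasts.\<close>

lemma AE_inc:
  assumes "\<beta> > 0"
  shows "AE \<omega> in M. \<forall>t. \<exists>i\<in>sites N. \<xi> (Suc t) \<omega> = inc (\<xi> t \<omega>) i"
proof -
  have "AE \<omega> in M. \<omega> \<in> past t x \<longrightarrow> (\<exists>i\<in>sites N. \<xi> (Suc t) \<omega> = inc (x t) i)" for t x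
  proof -
    let ?E = "{\<omega>\<in>past t x. \<not> (\<exists>i\<in>sites N. \<xi> (Suc t) \<omega> = inc (x t) i)}"
    have [measurable]: "?E \<in> sets M" by measurable
    have "prob ?E = (\<Sum>i\<in>sites N. prob (?E \<inter> {\<omega>\<in>space M. \<xi> (Suc t) \<omega> = inc (x t) i}))"
      by (rule prob_split_step[OF assms]) auto
    also have "\<dots> = (\<Sum>i\<in>sites N. 0)"
    proof (intro sum.cong refl)
      fix i assume "i \<in> sites N"
      then have "?E \<inter> {\<omega>\<in>space M. \<xi> (Suc t) \<omega> = inc (x t) i} = {}" by blast
      then show "prob (?E \<inter> {\<omega>\<in>space M. \<xi> (Suc t) \<omega> = inc (x t) i}) = 0" by (simp only: measure_empty)
    qed
    finally have "prob ?E = 0" by simp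
    then have "AE \<omega> in M. \<omega> \<notin> ?E" by (simp add: prob_eq_0)
    then show ?thesis by eventually_elim auto
  qed
  then have "AE \<omega> in M. \<forall>t. \<forall>x\<in>histories t. \<omega> \<in> past t x \<longrightarrow> (\<exists>i\<in>sites N. \<xi> (Suc t) \<omega> = inc (x t) i)"
    by (simp add: AE_all_countable AE_ball_countable countable_histories)
  then show ?thesis
  proof (rule AE_mp, intro AE_I2 impI allI)
    fix \<omega> t assume *: "\<omega> \<in> space M" "\<forall>t. \<forall>x\<in>histories t. \<omega> \<in> past t x \<longrightarrow> (\<exists>i\<in>sites N. \<xi> (Suc t) \<omega> = inc (x t) i)"
    show "\<exists>i\<in>sites N. \<xi> (Suc t) \<omega> = inc (\<xi> t \<omega>) i"
      using *(2)[rule_format, OF history_in[OF *(1)] past_history[OF *(1)], of t] by simp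
  qed
qed


text \<open>The events of staying in \<open>S\<close> for \<open>n\<close> steps decrease to that of
  staying forever, so continuity from above passes a bound uniform in \<open>n\<close> to the
  limit.\<close>

lemma prob_stay_le:
  assumes "\<beta> > 0" "\<And>n. \<epsilon> \<le> (killed N \<beta> S ^^ n) (\<lambda>_. 1) (x t)"
  shows "\<epsilon> * prob (past t x) \<le> prob {\<omega>\<in>past t x. \<forall>s>t. \<xi> s \<omega> \<in> S}"
proof -
  define A where "A n = {\<omega>\<in>past t x. \<forall>s\<in>{t<..t+n}. \<xi> s \<omega> \<in> S}" for n
  have "A n \<in> sets M" for n unfolding A_def by measurable
  then have A: "range A \<subseteq> sets M" by blast
  have "decseq A"
    unfolding A_def decseq_def by fastforce
  with A have "(\<lambda>n. prob (A n)) \<longlonglongrightarrow> prob (\<Inter>n. A n)"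
    by (intro finite_Lim_measure_decseq)
  moreover have "prob (A n) = prob (past t x) * (killed N \<beta> S ^^ n) (\<lambda>_. 1) (x t)" for n
    using prob_killed_path[OF assms(1), of t x n S UNIV] by (simp add: A_def indicator_def[abs_def])
  then have "\<epsilon> * prob (past t x) \<le> prob (A n)" for n
    using mult_right_mono[OF assms(2)[of n] measure_nonneg, of M "past t x"] by (simp add: mult.commute)
  ultimately have "\<epsilon> * prob (past t x) \<le> prob (\<Inter>n. A n)"
    by (meson LIMSEQ_le_const)
  also have "(\<Inter>n. A n) = {\<omega>\<in>past t x. \<forall>s>t. \<xi> s \<omega> \<in> S}"
  proof -
    have "\<xi> s \<omega> \<in> S" if "\<forall>n. \<forall>s\<in>{t<..t+n}. \<xi> s \<omega> \<in> S" "s > t" for s \<omega>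
      using that(1)[rule_format, of s s] that(2) by auto
    then show ?thesis unfolding A_def by auto
  qed
  finally show ?thesis .
qed

text \<open>
  Last-exit decomposition: the events ``\<open>B\<close> occurs at time \<open>t\<close> and never again'' are disjoint and
  have probability at least \<open>\<epsilon> \<cdot> P(B\<^sub>t)\<close>, so \<open>\<Sum>\<^sub>t P(B\<^sub>t) \<le> 1 / \<epsilon>\<close> and Borel--Cantelli applies.
\<close>

lemma AE_finite_occurrences:
  assumes "\<beta> > 0" "\<epsilon> > 0"
    and adapted: "\<And>t x y. (\<And>s. s \<le> t \<Longrightarrow> x s = y s) \<Longrightarrow> B t x \<longleftrightarrow> B t y"
    and escape: "\<And>t x. B t x \<Longrightarrow> \<exists>S. (\<forall>n. \<epsilon> \<le> (killed N \<beta> S ^^ n) (\<lambda>_. 1) (x t)) \<and>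
      (\<forall>y. (\<forall>s\<le>t. y s = x s) \<longrightarrow> (\<forall>s>t. y s \<in> S) \<longrightarrow> (\<forall>s>t. \<not> B s y))"
  shows "AE \<omega> in M. eventually (\<lambda>t. \<not> B t (\<lambda>s. \<xi> s \<omega>)) sequentially"
proof -
  define E where "E t = {\<omega>\<in>space M. B t (\<lambda>s. \<xi> s \<omega>)}" for t
  define L where "L t = {\<omega>\<in>space M. \<forall>s>t. \<not> B s (\<lambda>s. \<xi> s \<omega>)}" for t
  define I where "I t = {x\<in>histories t. B t x}" for t
  have cI: "countable (I t)" for t
    unfolding I_def using countable_histories by (rule countable_subset[rotated]) auto
  have E_past: "E t = (\<Union>x\<in>I t. past t x)" for t
  proof (intro set_eqI iffI)
    fix \<omega> assume w: "\<omega> \<in> E t"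
    then have "B t (restrict (\<lambda>s. \<xi> s \<omega>) {..t})"
      using adapted[of t "restrict (\<lambda>s. \<xi> s \<omega>) {..t}" "\<lambda>s. \<xi> s \<omega>"] by (simp add: E_def)
    with w show "\<omega> \<in> (\<Union>x\<in>I t. past t x)"
      using history_in past_history unfolding E_def I_def by blast
  next
    fix \<omega> assume "\<omega> \<in> (\<Union>x\<in>I t. past t x)"
    then obtain x where "B t x" "\<omega> \<in> past t x" by (auto simp: I_def)
    then show "\<omega> \<in> E t"
      using adapted[of t x "\<lambda>s. \<xi> s \<omega>"] by (auto simp: E_def past_def)
  qed
  have E_sets [measurable]: "E t \<in> sets M" for t
    unfolding E_past by (intro sets.countable_UN'' cI past_sets)
  have "L t = space M - (\<Union>s\<in>{t<..}. E s)" for t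
    unfolding L_def E_def by auto
  then have L_sets [measurable]: "L t \<in> sets M" for t
    by (metis E_sets countableI_type sets.compl_sets sets.countable_UN'')
  have dis: "disjoint_family_on (past t) (I t)" for t
    using disjoint_past by (rule disjoint_family_on_mono[rotated]) (auto simp: I_def)
  \<comment> \<open>The set supplied by \<open>escape\<close> varies with the history, but the bound
    \<epsilon> is common. The estimate is therefore proved on each past and summed over the
    countable disjoint family, as an integral over the counting measure.\<close>
  have EL: "\<epsilon> * prob (E t) \<le> prob (E t \<inter> L t)" for t
  proof -
    have 1: "\<epsilon> * prob (past t x) \<le> prob (past t x \<inter> L t)" if x: "x \<in> I t" for x
    proof -
      from x obtain S where S: "\<And>n. \<epsilon> \<le> (killed N \<beta> S ^^ n) (\<lambda>_. 1) (x t)"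
        "\<And>y. (\<forall>s\<le>t. y s = x s) \<Longrightarrow> (\<forall>s>t. y s \<in> S) \<Longrightarrow> (\<forall>s>t. \<not> B s y)"
        using escape[of t x] unfolding I_def by blast
      have "\<epsilon> * prob (past t x) \<le> prob {\<omega>\<in>past t x. \<forall>s>t. \<xi> s \<omega> \<in> S}"
        using S(1) by (intro prob_stay_le assms)
      also have "\<dots> \<le> prob (past t x \<inter> L t)"
      proof (rule finite_measure_mono)
        show "{\<omega>\<in>past t x. \<forall>s>t. \<xi> s \<omega> \<in> S} \<subseteq> past t x \<inter> L t"
          using S(2) by (auto simp: L_def past_def)
      qed measurable
      finally show ?thesis .
    qed
    have "ennreal \<epsilon> * emeasure M (E t) = (\<integral>\<^sup>+x. ennreal \<epsilon> * emeasure M (past t x) \<partial>count_space (I t))"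
      unfolding E_past
      by (subst emeasure_UN_countable[OF _ cI dis]) (auto simp: nn_integral_cmult)
    also have "\<dots> \<le> (\<integral>\<^sup>+x. emeasure M (past t x \<inter> L t) \<partial>count_space (I t))"
      using 1 assms(2)
      by (intro nn_integral_mono) (auto simp: emeasure_eq_measure ennreal_mult[symmetric] intro!: ennreal_leI)
    also have "\<dots> = emeasure M (\<Union>x\<in>I t. past t x \<inter> L t)"
      by (rule emeasure_UN_countable[OF _ cI, symmetric])
         (use dis in \<open>auto simp: disjoint_family_on_def\<close>)
    also have "(\<Union>x\<in>I t. past t x \<inter> L t) = E t \<inter> L t" unfolding E_past by blast
    finally show ?thesis
      using assms(2) by (simp add: emeasure_eq_measure ennreal_mult[symmetric])
  qed
  have "sum (\<lambda>t. prob (E t)) {..<n} \<le> 1 / \<epsilon>" for n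
  proof -
    have "\<epsilon> * sum (\<lambda>t. prob (E t)) {..<n} \<le> (\<Sum>t<n. prob (E t \<inter> L t))"
      unfolding sum_distrib_left by (intro sum_mono EL)
    also have "\<dots> = prob (\<Union>t<n. E t \<inter> L t)"
    proof (rule finite_measure_finite_Union[symmetric])
      have "E s \<inter> L s \<inter> (E t \<inter> L t) = {}" if "s < t" for s t
        using that by (auto simp: E_def L_def)
      then show "disjoint_family_on (\<lambda>t. E t \<inter> L t) {..<n}"
        unfolding disjoint_family_on_def by (metis inf_commute nat_neq_iff)
    qed auto
    also have "\<dots> \<le> 1" by (rule prob_le_1)
    finally show ?thesis using assms(2) by (simp add: field_simps)
  qed
  then have "summable (\<lambda>t. prob (E t))"
    by (intro summableI_nonneg_bounded) auto
  then have "AE \<omega> in M. eventually (\<lambda>t. \<omega> \<in> space M - E t) sequentially"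
    by (intro borel_cantelli_AE1) (auto simp: emeasure_eq_measure)
  then show ?thesis
    by eventually_elim (auto simp: E_def elim!: eventually_mono)
qed

end

section \<open>Localisation for \<open>\<beta> > 1\<close>\<close>

lemma next_site_in: "i \<in> sites N \<Longrightarrow> next_site N i \<in> sites N"
  and prev_site_in: "i \<in> sites N \<Longrightarrow> prev_site N i \<in> sites N"
  by (auto simp: sites_def next_site_def prev_site_def)

lemma prev_next_site: "i \<in> sites N \<Longrightarrow> prev_site N (next_site N i) = i"
  and next_prev_site: "i \<in> sites N \<Longrightarrow> next_site N (prev_site N i) = i"
  by (auto simp: sites_def next_site_def prev_site_def)

lemma neighbourhood_subset: "i \<in> sites N \<Longrightarrow> neighbourhood N i \<subseteq> sites N"
  using next_site_in prev_site_in by (auto simp: neighbourhood_def)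

lemma neighbourhood_sym:
  "i \<in> sites N \<Longrightarrow> j \<in> sites N \<Longrightarrow> i \<in> neighbourhood N j \<longleftrightarrow> j \<in> neighbourhood N i"
  using prev_next_site[of i N] prev_next_site[of j N] next_prev_site[of i N] next_prev_site[of j N]
  by (auto simp: neighbourhood_def)

lemma finite_neighbourhood [simp]: "finite (neighbourhood N i)"
  by (simp add: neighbourhood_def)

text \<open>There are at least four sites, so the sites of the pair \<open>prev_site N k\<close>,
  \<open>k\<close> and the two sites flanking it are pairwise distinct.\<close>

lemma distinct_sites:
  assumes "N \<ge> 3" "k \<in> sites N"
  shows "prev_site N k \<noteq> k" "next_site N k \<noteq> k" "next_site N k \<noteq> prev_site N k"
    "prev_site N (prev_site N k) \<noteq> k" "prev_site N (prev_site N k) \<noteq> prev_site N k"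
    "prev_site N (prev_site N k) \<notin> neighbourhood N k"
  using assms by (auto simp: sites_def next_site_def prev_site_def neighbourhood_def)

lemma potential_eq:
  assumes "N \<ge> 3" "k \<in> sites N"
  shows "potential N x k = x (prev_site N k) + x k + x (next_site N k)"
  using distinct_sites[OF assms] by (simp add: potential_def neighbourhood_def)

lemma potential_off_pair:
  assumes "i \<noteq> j" "\<And>r. r \<notin> {i, j} \<Longrightarrow> y r = x r" "y i = x i + m" "y j = x j + n"
  shows "potential N y r = potential N x r + (if i \<in> neighbourhood N r then m else 0)
    + (if j \<in> neighbourhood N r then n else 0)"
proof -
  have "y r = x r + (if r = i then m else 0) + (if r = j then n else 0)" for r
    using assms by auto
  then show ?thesis
    unfolding potential_def by (simp add: sum.distrib sum.delta')
qed

text \<open>\<open>1 + u \<le> exp u\<close> turns the product into a geometric sum. Uniformity in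
  \<open>m\<close> keeps the subsolution of the next lemma bounded.\<close>

lemma prod_one_plus_powers_le:
  fixes q :: real
  assumes "0 \<le> q" "q < 1" "a \<ge> 0"
  shows "(\<Prod>l<m. 1 + a * q ^ l) \<le> exp (a / (1 - q))"
proof -
  have "(\<Prod>l<m. 1 + a * q ^ l) \<le> (\<Prod>l<m. exp (a * q ^ l))"
    using assms by (intro prod_mono) auto
  also have "\<dots> = exp (a * (\<Sum>l<m. q ^ l))"
    by (simp add: exp_sum sum_distrib_left)
  also have "(\<Sum>l<m. q ^ l) \<le> 1 / (1 - q)"
    using assms by (simp add: sum_gp_strict divide_right_mono)
  finally show ?thesis using assms by (simp add: mult_left_mono)
qed

text \<open>The subsolution \<open>h\<close> is a product of a function of the growth
  \<open>m\<close> of \<open>i\<close> and one of the growth \<open>n\<close> of \<open>j\<close>. A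
  step at \<open>i\<close> or \<open>j\<close> multiplies it by
  \<open>1 + (real N + 1) * q ^ m\<close> or \<open>1 + q ^ n\<close>, which pays for the weight
  outside the pair. Both products are bounded, so scaling by \<epsilon> keeps \<open>h\<close> below
  1, and \<open>h x\<close> equals \<epsilon>.\<close>

lemma stay_in_pair:
  fixes x :: "nat \<Rightarrow> nat"
  assumes "\<beta> > 1" "i \<in> sites N" "j \<in> sites N" "l \<in> sites N" "i \<noteq> j" "j \<noteq> l" "i \<noteq> l"
    and nb: "neighbourhood N i = {i, j, l}" "l \<notin> neighbourhood N j" 
    and argmax: "\<And>r. r \<in> sites N \<Longrightarrow> potential N x r \<le> potential N x i"
    and second: "potential N x l \<le> potential N x j"
  shows "exp (- (real N + 2) / (1 - 1 / \<beta>))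
    \<le> (killed N \<beta> {y. (\<forall>r. r \<notin> {i, j} \<longrightarrow> y r = x r) \<and> x i \<le> y i \<and> x j \<le> y j} ^^ n) (\<lambda>_. 1) x"
proof -
  define q where "q = 1 / \<beta>"
  have q: "0 < q" "q < 1" and bq: "\<beta> ^ m * q ^ m = 1" for m
    using assms(1) by (auto simp: q_def power_divide)
  define f where "f m = (\<Prod>l<m. 1 + (real N + 1) * q ^ l)" for m :: nat
  define g where "g m = (\<Prod>l<m. 1 + 1 * q ^ l)" for m :: nat
  define \<epsilon> where "\<epsilon> = exp (- (real N + 2) / (1 - q))"
  define S where "S = {y. (\<forall>r. r \<notin> {i, j} \<longrightarrow> y r = x r) \<and> x i \<le> y i \<and> x j \<le> y j}"
  define h where "h y = f (y i - x i) * g (y j - x j) * \<epsilon>" for y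
  have f: "f m \<le> exp ((real N + 1) / (1 - q))" and g: "g m \<le> exp (1 / (1 - q))" for m
    unfolding f_def g_def using q by (intro prod_one_plus_powers_le; simp)+
  have f0: "f m \<ge> 0" and g0: "g m \<ge> 0" for m
    unfolding f_def g_def using q by (auto intro!: prod_nonneg)
  have fg1: "f m * g n * \<epsilon> \<le> 1" for m n
  proof -
    have "f m * g n * \<epsilon> \<le> exp ((real N + 1) / (1 - q)) * exp (1 / (1 - q)) * \<epsilon>"
      using f g f0 g0 by (intro mult_right_mono mult_mono) (auto simp: \<epsilon>_def)
    also have "\<dots> = 1"
      by (simp add: \<epsilon>_def exp_add[symmetric] add_divide_distrib[symmetric])
    finally show ?thesis .
  qed
  have sub: "h y \<le> killed N \<beta> S h y" if y: "y \<in> S" for y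
  proof -
    define m n where "m = y i - x i" and "n = y j - x j"
    define w where "w r = \<beta> ^ potential N y r" for r
    define W where "W = (\<Sum>r\<in>sites N. w r)"
    have w: "w r > 0" for r using assms(1) by (simp add: w_def)
    have W: "W > 0" unfolding W_def w_def using assms(1) by (intro weight_sum_pos) auto
    have p: "step_prob N \<beta> y r = w r / W" for r
      by (simp add: step_prob_def w_def W_def)
    have pot: "potential N y r = potential N x r + (if i \<in> neighbourhood N r then m else 0)
      + (if j \<in> neighbourhood N r then n else 0)" for r
      using y assms(5) by (intro potential_off_pair) (auto simp: S_def m_def n_def)
    have nbi: "i \<in> neighbourhood N r \<longleftrightarrow> r \<in> {i, j, l}" if "r \<in> sites N" for r
      using neighbourhood_sym[OF assms(2) that] nb(1) by simp
    have nbj: "j \<in> neighbourhood N i" "j \<in> neighbourhood N j" "j \<notin> neighbourhood N l"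
      using nb neighbourhood_sym[OF assms(3,4)] by (auto simp: neighbourhood_def)
    \<comment> \<open>\<open>l\<close> is a neighbour of \<open>i\<close> but not of
      \<open>j\<close>: growth of \<open>i\<close> raises the potentials of \<open>l\<close> and
      \<open>j\<close> equally, growth of \<open>j\<close> raises only that of \<open>j\<close>, and
      \<open>second\<close> orders them at the start.\<close>
    have wl: "w l \<le> w j * q ^ n"
    proof -
      have "w l * \<beta> ^ n \<le> w j"
        unfolding w_def power_add[symmetric] using assms(1-4) second nbi nbj
        by (intro power_increasing) (auto simp: pot)
      then have "w l * \<beta> ^ n * q ^ n \<le> w j * q ^ n" using q by (intro mult_right_mono) auto
      then show ?thesis by (simp add: mult.assoc bq)
    qed
    \<comment> \<open>Outside \<open>{i, j, l}\<close> no site has \<open>i\<close> as a neighbour,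
      so growth of \<open>i\<close> has no effect there; growth of \<open>j\<close> adds at most
      what it adds to the potential of \<open>i\<close>.\<close>
    have wr: "w r \<le> w i * q ^ m" if r: "r \<in> sites N - {i, j, l}" for r
    proof -
      have "w r * \<beta> ^ m \<le> w i"
        unfolding w_def power_add[symmetric] using assms(1,2) r argmax[of r] nbi[of r] nbi[of i] nbj
        by (intro power_increasing) (auto simp: pot)
      then have "w r * \<beta> ^ m * q ^ m \<le> w i * q ^ m" using q by (intro mult_right_mono) auto
      then show ?thesis by (simp add: mult.assoc bq)
    qed
    have "W = (\<Sum>r\<in>{i, j, l}. w r) + (\<Sum>r\<in>sites N - {i, j, l}. w r)"
      unfolding W_def using assms(2-4) by (subst sum.subset_diff[of "{i, j, l}"]) auto
    also have "\<dots> \<le> (w i + w j + w j * q ^ n) + (\<Sum>r\<in>sites N - {i, j, l}. w i * q ^ m)"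
      using wl wr assms(5-7) by (intro add_mono sum_mono) auto
    also have "(\<Sum>r\<in>sites N - {i, j, l}. w i * q ^ m) = real (card (sites N - {i, j, l})) * (w i * q ^ m)"
      by simp
    also have "\<dots> \<le> (real N + 1) * (w i * q ^ m)"
    proof (rule mult_right_mono)
      have "card (sites N - {i, j, l}) \<le> card (sites N)" by (intro card_mono) auto
      then show "real (card (sites N - {i, j, l})) \<le> real N + 1" by simp
    qed (use w[of i] q in auto)
    \<comment> \<open>The two factors are the ratios of successive values of \<open>f\<close> and of
      \<open>g\<close>, so this is the subsolution inequality up to multiplication by
      \<open>h y\<close> and division by \<open>W\<close>.\<close>
    finally have key: "W \<le> w i * (1 + (real N + 1) * q ^ m) + w j * (1 + q ^ n)"
      by (simp add: algebra_simps)
    have inS: "inc y i \<in> S" "inc y j \<in> S"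
      using y assms(5) by (auto simp: S_def inc_def)
    have hi: "h (inc y i) = h y * (1 + (real N + 1) * q ^ m)"
      using y assms(5) by (auto simp: h_def inc_def m_def S_def f_def Suc_diff_le)
    have hj: "h (inc y j) = h y * (1 + q ^ n)"
      using y assms(5) by (auto simp: h_def inc_def n_def S_def g_def Suc_diff_le)
    have h0: "h z \<ge> 0" for z using f0 g0 by (simp add: h_def \<epsilon>_def)
    have "h y * W \<le> h y * (w i * (1 + (real N + 1) * q ^ m) + w j * (1 + q ^ n))"
      by (intro mult_left_mono key h0)
    then have "h y \<le> h y * (w i * (1 + (real N + 1) * q ^ m) + w j * (1 + q ^ n)) / W"
      using W by (simp only: pos_le_divide_eq)
    also have "\<dots> = w i / W * h (inc y i) + w j / W * h (inc y j)"
      unfolding hi hj using W by (simp add: field_simps)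
    also have "\<dots> = (\<Sum>r\<in>{i, j}. step_prob N \<beta> y r * (indicator S (inc y r) * h (inc y r)))"
      using assms(5) inS by (simp add: p)
    also have "\<dots> \<le> killed N \<beta> S h y"
      unfolding killed_def using assms(1-3) h0
      by (intro sum_mono2) (auto intro!: mult_nonneg_nonneg less_imp_le[OF step_prob_pos])
    finally show ?thesis .
  qed
  have "h x \<le> (killed N \<beta> S ^^ n) (\<lambda>_. 1) x"
    using assms(1) fg1 by (intro subsolution_le_stay sub) (auto simp: S_def h_def)
  then show ?thesis
    by (simp add: h_def f_def g_def \<epsilon>_def S_def q_def)
qed

text \<open>A maximiser \<open>i\<close> of the potential is paired with its neighbour of larger
  potential, and the other neighbour is the \<open>l\<close> of \<open>stay_in_pair\<close>. A pair
  is named by its later site, hence \<open>k\<close> is \<open>next_site N i\<close> or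
  \<open>i\<close>; enlarging the set removes the growth constraints.\<close>

lemma exists_stay_pair:
  assumes "N \<ge> 3" "\<beta> > 1"
  shows "\<exists>k\<in>sites N. \<forall>n. exp (- (real N + 2) / (1 - 1 / \<beta>))
    \<le> (killed N \<beta> {y. \<forall>r. r \<notin> {prev_site N k, k} \<longrightarrow> y r = x r} ^^ n) (\<lambda>_. 1) x"
proof -
  have "finite (potential N x ` sites N)" "potential N x ` sites N \<noteq> {}" by auto
  from Max_in[OF this] obtain i where i: "i \<in> sites N" "potential N x i = Max (potential N x ` sites N)"
    by (metis imageE)
  then have argmax: "potential N x r \<le> potential N x i" if "r \<in> sites N" for r
    using that by simp
  note in_sites = i(1) prev_site_in[OF i(1)] next_site_in[OF i(1)]
  note d = distinct_sites[OF assms(1) i(1)]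
  \<comment> \<open>With four or more sites the two neighbours of \<open>i\<close> are not adjacent
    to each other.\<close>
  have nb: "next_site N i \<notin> neighbourhood N (prev_site N i)"
    using i(1) assms(1) by (auto simp: neighbourhood_def sites_def next_site_def prev_site_def split: if_splits)
  then have nb': "prev_site N i \<notin> neighbourhood N (next_site N i)"
    using neighbourhood_sym in_sites by blast
  have widen: "(killed N \<beta> S ^^ n) (\<lambda>_. 1) x \<le> (killed N \<beta> S' ^^ n) (\<lambda>_. 1) x" if "S \<subseteq> S'" for S S' n
  proof (induction n arbitrary: x)
    case (Suc n)
    have "killed N \<beta> S f x \<le> killed N \<beta> S' f' x" if "\<And>y. 0 \<le> f' y" "\<And>y. f y \<le> f' y" for f f' x
      unfolding killed_def using assms(2) that \<open>S \<subseteq> S'\<close>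
      by (intro sum_mono mult_left_mono less_imp_le[OF step_prob_pos]) (auto split: split_indicator)
    from this[OF killed_funpow_nonneg Suc] show ?case using assms(2) by simp
  qed simp
  show ?thesis
  proof (cases "potential N x (prev_site N i) \<le> potential N x (next_site N i)")
    case True
    show ?thesis
    proof (intro bexI[of _ "next_site N i"] allI)
      fix n
      have "exp (- (real N + 2) / (1 - 1 / \<beta>)) \<le> (killed N \<beta> {y. (\<forall>r. r \<notin> {i, next_site N i} \<longrightarrow> y r = x r)
          \<and> x i \<le> y i \<and> x (next_site N i) \<le> y (next_site N i)} ^^ n) (\<lambda>_. 1) x"
        using d in_sites argmax True nb' assms
        by (intro stay_in_pair[where l="prev_site N i"]) (auto simp: neighbourhood_def)
      also have "\<dots> \<le> (killed N \<beta> {y. \<forall>r. r \<notin> {prev_site N (next_site N i), next_site N i} \<longrightarrow> y r = x r} ^^ n) (\<lambda>_. 1) x"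
        by (rule widen) (auto simp: prev_next_site[OF i(1)])
      finally show "exp (- (real N + 2) / (1 - 1 / \<beta>)) \<le> \<dots>" .
    qed fact
  next
    case False
    show ?thesis
    proof (intro bexI[of _ i] allI)
      fix n
      have "exp (- (real N + 2) / (1 - 1 / \<beta>)) \<le> (killed N \<beta> {y. (\<forall>r. r \<notin> {i, prev_site N i} \<longrightarrow> y r = x r)
          \<and> x i \<le> y i \<and> x (prev_site N i) \<le> y (prev_site N i)} ^^ n) (\<lambda>_. 1) x"
        using d in_sites argmax False nb assms
        by (intro stay_in_pair[where l="next_site N i"]) (auto simp: neighbourhood_def)
      also have "\<dots> \<le> (killed N \<beta> {y. \<forall>r. r \<notin> {prev_site N i, i} \<longrightarrow> y r = x r} ^^ n) (\<lambda>_. 1) x"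
        by (rule widen) auto
      finally show "exp (- (real N + 2) / (1 - 1 / \<beta>)) \<le> \<dots>" .
    qed fact
  qed
qed

text \<open>
  The anchor is the latest restart time: a path stays anchored at \<open>a\<close> while it remains in
  \<open>R (y a)\<close> and restarts as soon as it leaves that set. Unlike the first time after which a path
  never leaves, it is determined by the past.
\<close>

primrec anchor :: "('s \<Rightarrow> 's set) \<Rightarrow> (nat \<Rightarrow> 's) \<Rightarrow> nat \<Rightarrow> nat" where
  "anchor R y 0 = 0"
| "anchor R y (Suc t) = (if y (Suc t) \<in> R (y (anchor R y t)) then anchor R y t else Suc t)"

lemma anchor_le: "anchor R y t \<le> t"
  by (induction t) auto

lemma anchor_cong: "(\<And>s. s \<le> t \<Longrightarrow> x s = y s) \<Longrightarrow> anchor R x t = anchor R y t"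
proof (induction t)
  case (Suc t)
  then have "anchor R x t = anchor R y t" by simp
  moreover have "anchor R y t \<le> Suc t" using anchor_le[of R y t] by simp
  ultimately show ?case using Suc.prems by simp
qed simp

text \<open>Every later membership test succeeds, so nothing triggers a restart; this is how staying
  in \<open>R (y t)\<close> excludes further restarts.\<close>

lemma anchor_stays:
  assumes "anchor R y t = t" "\<And>s. s > t \<Longrightarrow> y s \<in> R (y t)" "t \<le> s"
  shows "anchor R y s = t"
  using assms(3)
proof (induction s rule: dec_induct)
  case (step s)
  then show ?case using assms(2)[of "Suc s"] by simp
qed (use assms in auto)

text \<open>Once restarts have ceased the anchor is constant, and each later time has passed the
  membership test for that single anchor. The test concerns the new time \<open>Suc s\<close>, so
  the threshold becomes \<open>Suc T\<close>.\<close>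

lemma anchor_eventually:
  assumes "eventually (\<lambda>t. anchor R y t \<noteq> t) sequentially"
  shows "\<exists>a T. \<forall>s\<ge>T. y s \<in> R (y a)"
proof -
  from assms obtain T where T: "\<And>t. t \<ge> T \<Longrightarrow> anchor R y t \<noteq> t"
    by (auto simp: eventually_sequentially)
  have step: "anchor R y (Suc s) = anchor R y s \<and> y (Suc s) \<in> R (y (anchor R y s))" if "s \<ge> T" for s
    using T[of "Suc s"] that by (auto split: if_splits)
  have const: "anchor R y s = anchor R y T" if "s \<ge> T" for s
    using that by (induction s rule: dec_induct) (use step in metis)+
  have "y s \<in> R (y (anchor R y T))" if "s \<ge> Suc T" for s
  proof -
    from that obtain s' where "s = Suc s'" "s' \<ge> T" by (cases s) auto
    then show ?thesis using step[of s'] const[of s'] by simp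
  qed
  then show ?thesis by blast
qed

section \<open>Law of large numbers inside a pair\<close>

lemma killed_funpow_eigen:
  assumes "\<beta> > 0" "\<And>y. 0 \<le> f y" "c \<ge> 0" "\<And>y. y \<in> S \<Longrightarrow> killed N \<beta> S f y \<le> c * f y" "x \<in> S"
  shows "(killed N \<beta> S ^^ n) f x \<le> c ^ n * f x"
  using assms(5)
proof (induction n arbitrary: x)
  case (Suc n)
  have "(killed N \<beta> S ^^ Suc n) f x = killed N \<beta> S ((killed N \<beta> S ^^ n) f) x" by simp
  also have "\<dots> \<le> killed N \<beta> S (\<lambda>y. c ^ n * f y) x"
    by (intro killed_mono assms Suc)
  also have "\<dots> = c ^ n * killed N \<beta> S f x"
    unfolding killed_def sum_distrib_left by (intro sum.cong) (auto simp: mult_ac)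
  also have "\<dots> \<le> c ^ n * (c * f x)"
    using assms Suc by (intro mult_left_mono) auto
  finally show ?case by (simp add: mult_ac)
qed simp

text \<open>The neighbourhoods of \<open>k\<close> and \<open>prev_site N k\<close> share exactly
  the pair itself, so growth of the pair cancels and the flanking sites remain. While these are
  frozen, the weight ratio of the pair is constant.\<close>

lemma potential_diff_pair:
  assumes "N \<ge> 3" "k \<in> sites N"
  shows "int (potential N x k) - int (potential N x (prev_site N k))
    = int (x (next_site N k)) - int (x (prev_site N (prev_site N k)))"
  using potential_eq[OF assms] potential_eq[OF assms(1) prev_site_in[OF assms(2)]]
  by (simp add: next_prev_site[OF assms(2)])

text \<open>The bounds are the step probabilities of a chain on the pair alone; the other sites only
  enlarge the denominator. Upper bounds suffice for estimating the killed operator from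
  above.\<close>

lemma step_prob_pair_le:
  assumes "N \<ge> 3" "k \<in> sites N" "\<beta> > 0"
    and "r = \<beta> powi (int (y (next_site N k)) - int (y (prev_site N (prev_site N k))))"
  shows "step_prob N \<beta> y k \<le> r / (1 + r)" "step_prob N \<beta> y (prev_site N k) \<le> 1 / (1 + r)"
proof -
  let ?j = "prev_site N k"
  define W where "W = (\<Sum>r\<in>sites N. \<beta> ^ potential N y r)"
  define v where "v = \<beta> ^ potential N y ?j"
  have v: "v > 0" using assms(3) by (simp add: v_def)
  have r: "r > 0" using assms(3,4) by simp
  have k: "\<beta> ^ potential N y k = r * v"
    unfolding assms(4) potential_diff_pair[OF assms(1,2), symmetric] v_def
    using assms(3) by (simp add: power_int_diff)
  have "(\<Sum>r\<in>{k, ?j}. \<beta> ^ potential N y r) \<le> W"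
    unfolding W_def using assms(3) assms(2) prev_site_in[OF assms(2)] by (intro sum_mono2) auto
  then have W: "r * v + v \<le> W"
    using distinct_sites(1)[OF assms(1,2)] k v_def by (simp add: insert_Diff_if)
  have "r * v / W \<le> r * v / (r * v + v)" "v / W \<le> v / (r * v + v)"
    using W v r by (auto intro!: divide_left_mono mult_pos_pos add_pos_pos intro: less_le_trans[OF _ W])
  moreover have "r * v / (r * v + v) = r / (1 + r)" "v / (r * v + v) = 1 / (1 + r)"
    using v r add_pos_pos[OF mult_pos_pos[OF r v] v] by (auto simp: field_simps)
  ultimately show "step_prob N \<beta> y k \<le> r / (1 + r)" "step_prob N \<beta> y ?j \<le> 1 / (1 + r)"
    by (simp_all add: step_prob_def W_def[symmetric] k v_def[symmetric])
qed

text \<open>As a function of \<theta> the left side is 1 at 0 with derivative -\<delta>: the terms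
  in \<sigma> cancel because a step of 1 with probability \<open>r / (1 + r)\<close> and of
  \<open>- r\<close> otherwise has mean zero.\<close>

lemma exists_contracting_exponent:
  fixes r \<delta> :: real
  assumes "r > 0" "\<delta> > 0"
  shows "\<exists>\<theta>>0. (r / (1 + r) * exp (\<theta> * \<sigma>) + 1 / (1 + r) * exp (- \<theta> * \<sigma> * r)) * exp (- \<theta> * \<delta>) < 1"
proof -
  define p q where "p = r / (1 + r)" and "q = 1 / (1 + r)"
  define \<phi> where "\<phi> \<theta> = (p * exp (\<theta> * \<sigma>) + q * exp (- \<theta> * \<sigma> * r)) * exp (- \<theta> * \<delta>)" for \<theta>
  have sum1: "p + q = 1" and pq: "p = r * q" using assms by (simp_all add: p_def q_def divide_simps)
  have "(\<phi> has_field_derivative - \<delta> * (p + q)) (at 0)"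
    unfolding \<phi>_def pq by (auto intro!: derivative_eq_intros simp: algebra_simps)
  then have "DERIV \<phi> 0 :> - \<delta>" unfolding sum1 by simp
  from DERIV_neg_dec_right[OF this] assms obtain d where d: "d > 0" "\<And>h. 0 < h \<Longrightarrow> h < d \<Longrightarrow> \<phi> (0 + h) < \<phi> 0"
    by auto
  have "\<phi> (d / 2) < 1" using d(2)[of "d / 2"] d(1) sum1 by (simp add: \<phi>_def)
  with d(1) show ?thesis unfolding \<phi>_def p_def q_def by (intro exI[of _ "d / 2"]) auto
qed

text \<open>Since \<open>a n + b n\<close> grows by one per step, the deviation \<open>D\<close>
  determines both: \<open>b n / n\<close> tends to \<open>1 / (1 + r)\<close> and
  \<open>a n / n\<close> to \<open>r / (1 + r)\<close>. Positive rates give divergence, and their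
  quotient is \<open>r\<close>.\<close>

lemma ratio_from_deviation:
  fixes a b :: "nat \<Rightarrow> nat" and r :: real
  assumes r: "r > 0" and ab: "\<And>n. a n + b n = a 0 + b 0 + n"
    and dev: "\<And>\<delta>. \<delta> > 0 \<Longrightarrow>
      eventually (\<lambda>n. \<bar>(real (a n) - real (a 0)) - r * (real (b n) - real (b 0))\<bar> < \<delta> * real n) sequentially"
  shows "(\<lambda>n. real (a n) / real (b n)) \<longlonglongrightarrow> r"
    "filterlim a at_top sequentially" "filterlim b at_top sequentially"
proof -
  define D where "D n = (real (a n) - real (a 0)) - r * (real (b n) - real (b 0))" for n
  have D0: "(\<lambda>n. D n / real n) \<longlonglongrightarrow> 0"
  proof (rule tendstoI)
    fix e :: real assume "e > 0"
    from dev[OF this] eventually_gt_at_top[of 0]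
    show "eventually (\<lambda>n. dist (D n / real n) 0 < e) sequentially"
      by eventually_elim (auto simp: D_def[symmetric] dist_real_def abs_divide divide_simps)
  qed
  have sum: "real (a n) = real (a 0) + real (b 0) + real n - real (b n)" for n
    using ab[of n] by linarith
  have bn: "real (b n) = real (b 0) + (real n - D n) / (1 + r)" for n
    using r by (simp add: D_def sum[of n] field_simps)
  have inv: "(\<lambda>n. c / real n) \<longlonglongrightarrow> 0" for c :: real
    by (rule lim_const_over_n)
  have "(\<lambda>n. real (b 0) / real n + (1 - D n / real n) / (1 + r)) \<longlonglongrightarrow> 0 + (1 - 0) / (1 + r)"
    using r by (intro tendsto_intros inv D0) auto
  then have "(\<lambda>n. real (b n) / real n) \<longlonglongrightarrow> 0 + (1 - 0) / (1 + r)"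
  proof (rule Lim_transform_eventually)
    show "\<forall>\<^sub>F n in sequentially. real (b 0) / real n + (1 - D n / real n) / (1 + r) = real (b n) / real n"
      using eventually_gt_at_top[of 0]
    proof eventually_elim
      case (elim n)
      have "(real n - D n) / (1 + r) / real n = (1 - D n / real n) / (1 + r)"
      proof -
        have "(real n - D n) / (1 + r) / real n = (real n - D n) / real n / (1 + r)"
          by (simp only: divide_divide_eq_left mult.commute)
        also have "(real n - D n) / real n = 1 - D n / real n"
          using elim by (simp add: diff_divide_distrib)
        finally show ?thesis .
      qed
      then show ?case unfolding bn[of n] by (simp add: add_divide_distrib)
    qed
  qed
  then have lb: "(\<lambda>n. real (b n) / real n) \<longlonglongrightarrow> 1 / (1 + r)" by simp
  have "(\<lambda>n. (real (a 0) + real (b 0)) / real n + 1 - real (b n) / real n) \<longlonglongrightarrow> 0 + 1 - 1 / (1 + r)"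
    by (intro tendsto_intros inv lb)
  also have "0 + 1 - 1 / (1 + r) = r / (1 + r)" using r by (simp add: field_simps)
  finally have la: "(\<lambda>n. real (a n) / real n) \<longlonglongrightarrow> r / (1 + r)"
  proof (rule Lim_transform_eventually)
    show "\<forall>\<^sub>F n in sequentially. (real (a 0) + real (b 0)) / real n + 1 - real (b n) / real n = real (a n) / real n"
      using eventually_gt_at_top[of 0]
    proof eventually_elim
      case (elim n)
      then show ?case unfolding sum[of n] by (simp add: add_divide_distrib diff_divide_distrib)
    qed
  qed
  have "(\<lambda>n. (real (a n) / real n) / (real (b n) / real n)) \<longlonglongrightarrow> (r / (1 + r)) / (1 / (1 + r))"
    using r by (intro tendsto_divide la lb) auto
  also have "(r / (1 + r)) / (1 / (1 + r)) = r" using r by (simp add: field_simps)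
  finally show "(\<lambda>n. real (a n) / real (b n)) \<longlonglongrightarrow> r"
  proof (rule Lim_transform_eventually)
    show "\<forall>\<^sub>F n in sequentially. real (a n) / real n / (real (b n) / real n) = real (a n) / real (b n)"
      using eventually_gt_at_top[of 0] by eventually_elim simp
  qed
  have at_top: "filterlim c at_top sequentially" if "(\<lambda>n. real (c n) / real n) \<longlonglongrightarrow> l" "l > 0" for l and c :: "nat \<Rightarrow> nat"
  proof -
    have *: "filterlim (\<lambda>n. real (c n) / real n * real n) at_top sequentially"
      using that filterlim_real_sequentially by (rule filterlim_tendsto_pos_mult_at_top)
    have "eventually (\<lambda>n. real (c n) / real n * real n = real (c n)) sequentially"
      using eventually_gt_at_top[of 0] by eventually_elim simp
    from filterlim_cong[OF refl refl this] * have "filterlim (\<lambda>n. real (c n)) at_top sequentially"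
      by (rule iffD1)
    then show ?thesis by (simp add: filterlim_sequentially_iff_filterlim_real)
  qed
  show "filterlim a at_top sequentially" "filterlim b at_top sequentially"
    using at_top la lb r by auto
qed

text \<open>\<open>D\<close> changes by 1 when \<open>k\<close> grows and by \<open>- r\<close> when
  \<open>j\<close> grows, and \<open>r\<close> is the weight ratio throughout \<open>S\<close>
  because the flanking sites are frozen there. Every other step leaves \<open>S\<close> and is
  killed, so the exponential of \<open>D\<close> satisfies an eigenvalue inequality.\<close>

lemma killed_exp_le:
  fixes x :: "nat \<Rightarrow> nat" and \<sigma> \<theta> :: real
  assumes "N \<ge> 3" "k \<in> sites N" "\<beta> > 0"
    and j: "j = prev_site N k"
    and S: "S = {y. \<forall>i. i \<notin> {j, k} \<longrightarrow> y i = x i}"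
    and r: "r = \<beta> powi (int (x (next_site N k)) - int (x (prev_site N j)))"
    and D: "\<And>y. D y = (real (y k) - real (x k)) - r * (real (y j) - real (x j))"
    and y: "y \<in> S"
  shows "killed N \<beta> S (\<lambda>y. exp (\<theta> * (\<sigma> * D y))) y
    \<le> (r / (1 + r) * exp (\<theta> * \<sigma>) + 1 / (1 + r) * exp (- \<theta> * \<sigma> * r)) * exp (\<theta> * (\<sigma> * D y))"
proof -
  have jk: "j \<noteq> k" "j \<in> sites N" using distinct_sites[OF assms(1,2)] prev_site_in[OF assms(2)] j by auto
  let ?E = "\<lambda>y. exp (\<theta> * (\<sigma> * D y))"
  have off: "inc y i \<notin> S" if "i \<notin> {k, j}" for i
  proof
    assume "inc y i \<in> S"
    with that have "inc y i i = x i" unfolding S by blast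
    moreover have "y i = x i" using y that unfolding S by blast
    ultimately show False by (simp add: inc_def)
  qed
  have "killed N \<beta> S ?E y = (\<Sum>i\<in>{k, j}. step_prob N \<beta> y i * (indicator S (inc y i) * ?E (inc y i)))"
    unfolding killed_def using assms(2) jk off by (intro sum.mono_neutral_right) auto
  also have "\<dots> = step_prob N \<beta> y k * ?E (inc y k) + step_prob N \<beta> y j * ?E (inc y j)"
  proof -
    have "inc y k \<in> S" "inc y j \<in> S" using y unfolding S inc_def by auto
    then show ?thesis using jk by simp
  qed
  also have "?E (inc y k) = exp (\<theta> * \<sigma>) * ?E y"
    using jk by (simp add: D inc_def exp_add[symmetric] algebra_simps)
  also have "?E (inc y j) = exp (- \<theta> * \<sigma> * r) * ?E y"
    using jk by (simp add: D inc_def exp_add[symmetric] algebra_simps)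
  also have "step_prob N \<beta> y k * (exp (\<theta> * \<sigma>) * ?E y) + step_prob N \<beta> y j * (exp (- \<theta> * \<sigma> * r) * ?E y)
    \<le> r / (1 + r) * (exp (\<theta> * \<sigma>) * ?E y) + 1 / (1 + r) * (exp (- \<theta> * \<sigma> * r) * ?E y)"
  proof -
    have "next_site N k \<notin> {j, k}" "prev_site N j \<notin> {j, k}"
      using distinct_sites[OF assms(1,2)] j by auto
    then have "r = \<beta> powi (int (y (next_site N k)) - int (y (prev_site N (prev_site N k))))"
      using y unfolding r S j by auto
    from step_prob_pair_le[OF assms(1-3) this] show ?thesis
      unfolding j by (intro add_mono mult_right_mono) auto
  qed
  finally show ?thesis by (simp add: distrib_right mult.assoc)
qed

context growth_process
begin

text \<open>Chernoff bound: the killed exponential moment is at most \<open>\<gamma> ^ n\<close>,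
  and \<theta> makes \<open>\<gamma> * exp (- \<theta> * \<delta>)\<close> smaller than 1, so
  Borel--Cantelli applies. The values 1 and -1 of \<sigma> yield the two sides.\<close>

lemma AE_deviation:
  assumes "N \<ge> 3" "k \<in> sites N" "\<beta> > 0" "\<delta> > 0"
    and j: "j = prev_site N k"
    and S: "S = {y. \<forall>i. i \<notin> {j, k} \<longrightarrow> y i = x t i}"
    and r: "r = \<beta> powi (int (x t (next_site N k)) - int (x t (prev_site N j)))"
    and D: "\<And>y. D y = (real (y k) - real (x t k)) - r * (real (y j) - real (x t j))"
  shows "AE \<omega> in M. \<omega> \<in> past t x \<longrightarrow> (\<forall>s>t. \<xi> s \<omega> \<in> S) \<longrightarrow>
    eventually (\<lambda>n. \<sigma> * D (\<xi> (t + n) \<omega>) < \<delta> * real n) sequentially"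
proof -
  have r0: "r > 0" using r assms(3) by simp
  obtain \<theta> where \<theta>: "\<theta> > 0"
    "(r / (1 + r) * exp (\<theta> * \<sigma>) + 1 / (1 + r) * exp (- \<theta> * \<sigma> * r)) * exp (- \<theta> * \<delta>) < 1"
    using exists_contracting_exponent[OF r0 assms(4)] by blast
  define \<gamma> where "\<gamma> = r / (1 + r) * exp (\<theta> * \<sigma>) + 1 / (1 + r) * exp (- \<theta> * \<sigma> * r)"
  have \<gamma>: "\<gamma> \<ge> 0" using r0 by (simp add: \<gamma>_def)
  define F where "F n = {y. \<delta> * real n \<le> \<sigma> * D y}" for n :: nat
  define A where "A n = {\<omega>\<in>past t x. (\<forall>s\<in>{t<..t+n}. \<xi> s \<omega> \<in> S) \<and> \<xi> (t+n) \<omega> \<in> F n}" for n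
  have A_sets: "A n \<in> sets M" for n unfolding A_def by measurable
  let ?E = "\<lambda>y. exp (\<theta> * (\<sigma> * D y))"
  have A_le: "prob (A n) \<le> (\<gamma> * exp (- \<theta> * \<delta>)) ^ n" for n
  proof -
    have "(killed N \<beta> S ^^ n) (indicator (F n)) (x t) \<le> (killed N \<beta> S ^^ n) (\<lambda>y. exp (- \<theta> * \<delta>) ^ n * ?E y) (x t)"
    proof (rule killed_funpow_mono[OF assms(3)])
      fix y
      show "indicator (F n) y \<le> exp (- \<theta> * \<delta>) ^ n * ?E y"
      proof (cases "y \<in> F n")
        case True
        have "exp (- \<theta> * \<delta>) ^ n * ?E y = exp (real n * (- \<theta> * \<delta>)) * ?E y"
          by (simp only: exp_of_nat_mult)
        also have "\<dots> = exp (\<theta> * (\<sigma> * D y - \<delta> * real n))"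
          by (simp add: exp_add[symmetric] algebra_simps)
        finally show ?thesis using True \<theta>(1) by (simp add: F_def)
      qed simp
    qed
    also have "\<dots> \<le> \<gamma> ^ n * (exp (- \<theta> * \<delta>) ^ n * ?E (x t))"
    proof (rule killed_funpow_eigen[OF assms(3)])
      fix y assume "y \<in> S"
      then have "killed N \<beta> S ?E y \<le> \<gamma> * ?E y"
        unfolding \<gamma>_def by (intro killed_exp_le[OF assms(1-3) j S r D])
      then have "exp (- \<theta> * \<delta>) ^ n * killed N \<beta> S ?E y \<le> exp (- \<theta> * \<delta>) ^ n * (\<gamma> * ?E y)"
        by (intro mult_left_mono) auto
      moreover have "killed N \<beta> S (\<lambda>y. exp (- \<theta> * \<delta>) ^ n * ?E y) y = exp (- \<theta> * \<delta>) ^ n * killed N \<beta> S ?E y"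
        unfolding killed_def sum_distrib_left by (intro sum.cong) (auto simp: mult_ac)
      ultimately show "killed N \<beta> S (\<lambda>y. exp (- \<theta> * \<delta>) ^ n * ?E y) y \<le> \<gamma> * (exp (- \<theta> * \<delta>) ^ n * ?E y)"
        by (simp add: mult_ac)
    qed (use \<gamma> S in auto)
    also have "\<dots> = (\<gamma> * exp (- \<theta> * \<delta>)) ^ n" by (simp add: D power_mult_distrib)
    finally have "(killed N \<beta> S ^^ n) (indicator (F n)) (x t) \<le> (\<gamma> * exp (- \<theta> * \<delta>)) ^ n" .
    moreover have "0 \<le> (killed N \<beta> S ^^ n) (indicator (F n)) (x t)"
      by (intro killed_funpow_nonneg assms) auto
    moreover have "prob (A n) = prob (past t x) * (killed N \<beta> S ^^ n) (indicator (F n)) (x t)"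
      unfolding A_def by (rule prob_killed_path[OF assms(3)])
    ultimately show ?thesis
      using mult_right_mono[OF prob_le_1[of "past t x"], of "(killed N \<beta> S ^^ n) (indicator (F n)) (x t)"] by linarith
  qed
  have "summable (\<lambda>n. prob (A n))"
  proof (rule summable_comparison_test')
    show "summable (\<lambda>n. (\<gamma> * exp (- \<theta> * \<delta>)) ^ n)"
      using \<theta>(2)[folded \<gamma>_def] \<gamma> by (intro summable_geometric) simp
    show "norm (prob (A n)) \<le> (\<gamma> * exp (- \<theta> * \<delta>)) ^ n" if "n \<ge> 0" for n
      using A_le[of n] by simp
  qed
  then have "AE \<omega> in M. eventually (\<lambda>n. \<omega> \<in> space M - A n) sequentially"
    using A_sets by (intro borel_cantelli_AE1) (auto simp: emeasure_eq_measure)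
  then show ?thesis
  proof (rule AE_mp, intro AE_I2 impI)
    fix \<omega> assume *: "eventually (\<lambda>n. \<omega> \<in> space M - A n) sequentially" "\<omega> \<in> past t x" "\<forall>s>t. \<xi> s \<omega> \<in> S"
    from *(1) show "eventually (\<lambda>n. \<sigma> * D (\<xi> (t + n) \<omega>) < \<delta> * real n) sequentially"
    proof eventually_elim
      case (elim n)
      then have "\<xi> (t + n) \<omega> \<notin> F n" using *(2,3) unfolding A_def by auto
      then show ?case by (simp add: F_def)
    qed
  qed
qed

text \<open>The event counted is a restart of the anchor. At each restart the pair chosen for the
  current configuration is kept forever with probability at least \<epsilon>, which rules out
  further restarts, so \<open>AE_finite_occurrences\<close> leaves finitely many.\<close>

lemma AE_confined:
  assumes "N \<ge> 3" "\<beta> > 1"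
  shows "AE \<omega> in M. \<exists>k\<in>sites N. \<exists>T. \<forall>s\<ge>T. \<forall>i. i \<notin> {prev_site N k, k} \<longrightarrow> \<xi> s \<omega> i = \<xi> T \<omega> i"
proof -
  define \<epsilon> where "\<epsilon> = exp (- (real N + 2) / (1 - 1 / \<beta>))"
  define P where "P k x = {y. \<forall>i. i \<notin> {prev_site N k, k} \<longrightarrow> y i = x i}" for k and x :: "nat \<Rightarrow> nat"
  \<comment> \<open>One pair is chosen for each configuration in advance, so that \<open>R\<close>
    is a deterministic map and the anchor depends on the path only.\<close>
  define \<kappa> where "\<kappa> x = (SOME k. k \<in> sites N \<and> (\<forall>n. \<epsilon> \<le> (killed N \<beta> (P k x) ^^ n) (\<lambda>_. 1) x))" for x
  define R where "R x = P (\<kappa> x) x" for x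
  have \<kappa>: "\<kappa> x \<in> sites N" "\<epsilon> \<le> (killed N \<beta> (R x) ^^ n) (\<lambda>_. 1) x" for x n
  proof -
    have "\<exists>k. k \<in> sites N \<and> (\<forall>n. \<epsilon> \<le> (killed N \<beta> (P k x) ^^ n) (\<lambda>_. 1) x)"
      using exists_stay_pair[OF assms] unfolding \<epsilon>_def P_def by blast
    then have "\<kappa> x \<in> sites N \<and> (\<forall>n. \<epsilon> \<le> (killed N \<beta> (P (\<kappa> x) x) ^^ n) (\<lambda>_. 1) x)"
      unfolding \<kappa>_def by (rule someI_ex)
    then show "\<kappa> x \<in> sites N" "\<epsilon> \<le> (killed N \<beta> (R x) ^^ n) (\<lambda>_. 1) x"
      unfolding R_def by blast+
  qed
  have "AE \<omega> in M. eventually (\<lambda>t. \<not> anchor R (\<lambda>s. \<xi> s \<omega>) t = t) sequentially"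
  proof (rule AE_finite_occurrences[where \<epsilon>=\<epsilon> and B="\<lambda>t y. anchor R y t = t"])
    show "anchor R x t = t \<longleftrightarrow> anchor R y t = t" if "\<And>s. s \<le> t \<Longrightarrow> x s = y s" for x y and t :: nat
      using anchor_cong[OF that, where R=R] by (simp only:)
    fix t :: nat and x assume x: "anchor R x t = t"
    show "\<exists>S. (\<forall>n. \<epsilon> \<le> (killed N \<beta> S ^^ n) (\<lambda>_. 1) (x t)) \<and>
      (\<forall>y. (\<forall>s\<le>t. y s = x s) \<longrightarrow> (\<forall>s>t. y s \<in> S) \<longrightarrow> (\<forall>s>t. \<not> anchor R y s = s))"
    proof (intro exI[of _ "R (x t)"] conjI allI impI \<kappa>)
      fix y and s :: nat assume y: "\<forall>s\<le>t. y s = x s" "\<forall>s>t. y s \<in> R (x t)" and s: "t < s"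
      have "anchor R y t = anchor R x t" by (rule anchor_cong) (use y(1) in blast)
      then have yt: "anchor R y t = t" using x by (rule trans)
      have "y t = x t" using y(1) by blast
      then have "y r \<in> R (y t)" if "r > t" for r using y(2) that by (simp only:)
      from anchor_stays[OF yt this] have "anchor R y s = t" using s by simp
      then show "\<not> anchor R y s = s" using s by simp
    qed
  qed (use assms in \<open>auto simp: \<epsilon>_def\<close>)
  then show ?thesis
  proof eventually_elim
    case (elim \<omega>)
    from anchor_eventually[OF elim] obtain a T where "\<And>s. s \<ge> T \<Longrightarrow> \<xi> s \<omega> \<in> R (\<xi> a \<omega>)" by blast
    then have *: "\<xi> s \<omega> i = \<xi> a \<omega> i" if "s \<ge> T" "i \<notin> {prev_site N (\<kappa> (\<xi> a \<omega>)), \<kappa> (\<xi> a \<omega>)}" for s i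
      using that unfolding R_def P_def by blast
    have "\<xi> s \<omega> i = \<xi> T \<omega> i" if "s \<ge> T" "i \<notin> {prev_site N (\<kappa> (\<xi> a \<omega>)), \<kappa> (\<xi> a \<omega>)}" for s i
      using *[OF that] *[OF order_refl that(2)] by (rule trans[OF _ sym])
    then show ?case using \<kappa>(1)[of "\<xi> a \<omega>"] by blast
  qed
qed

text \<open>Confinement starts at a random time \<open>T\<close>, so the deviation bound is first
  made simultaneous over the countably many times, histories, sites, signs and accuracies
  \<open>1 / real (Suc m)\<close>. It is then applied to the actual history up to
  \<open>T\<close>.\<close>

lemma AE_localised:
  assumes "N \<ge> 3" "\<beta> > 1"
  shows "AE \<omega> in M. \<exists>k\<in>sites N. \<exists>T. (\<forall>s\<ge>T. \<forall>i. i \<notin> {prev_site N k, k} \<longrightarrow> \<xi> s \<omega> i = \<xi> T \<omega> i) \<and>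
    filterlim (\<lambda>t. \<xi> t \<omega> k) at_top sequentially \<and>
    filterlim (\<lambda>t. \<xi> t \<omega> (prev_site N k)) at_top sequentially \<and>
    (\<lambda>t. real (\<xi> t \<omega> k) / real (\<xi> t \<omega> (prev_site N k)))
      \<longlonglongrightarrow> \<beta> powi (int (\<xi> T \<omega> (next_site N k)) - int (\<xi> T \<omega> (prev_site N (prev_site N k))))"
proof -
  define r where "r k x = \<beta> powi (int (x (next_site N k)) - int (x (prev_site N (prev_site N k))))"
    for k and x :: "nat \<Rightarrow> nat"
  define D where "D k x y = (real (y k) - real (x k)) - r k x * (real (y (prev_site N k)) - real (x (prev_site N k)))"
    for k and x y :: "nat \<Rightarrow> nat"
  define P where "P k x = {y. \<forall>i. i \<notin> {prev_site N k, k} \<longrightarrow> y i = x i}" for k and x :: "nat \<Rightarrow> nat"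
  have \<beta>: "\<beta> > 0" using assms by simp
  have dev: "AE \<omega> in M. \<omega> \<in> past t x \<longrightarrow> (\<forall>s>t. \<xi> s \<omega> \<in> P k (x t)) \<longrightarrow>
      eventually (\<lambda>n. \<sigma> * D k (x t) (\<xi> (t + n) \<omega>) < 1 / real (Suc m) * real n) sequentially"
    if "k \<in> sites N" for t x k \<sigma> m
    by (rule AE_deviation[OF assms(1) that \<beta> _ refl P_def r_def D_def]) auto
  have pm: "countable {1, - 1 :: real}" by simp
  have "AE \<omega> in M. \<forall>k\<in>sites N. \<forall>m. \<forall>\<sigma>\<in>{1, -1}. \<forall>t. \<forall>x\<in>histories t.
      \<omega> \<in> past t x \<longrightarrow> (\<forall>s>t. \<xi> s \<omega> \<in> P k (x t)) \<longrightarrow>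
      eventually (\<lambda>n. \<sigma> * D k (x t) (\<xi> (t + n) \<omega>) < 1 / real (Suc m) * real n) sequentially"
    unfolding AE_all_countable AE_ball_countable[OF countable_histories] AE_ball_countable[OF pm]
      AE_ball_countable[OF countable_finite[OF finite_sites]]
    by (intro ballI allI dev)
  then show ?thesis
    using AE_confined[OF assms] AE_inc[OF \<beta>] AE_space
  proof eventually_elim
    case (elim \<omega>)
    from elim(2) obtain k T where k: "k \<in> sites N"
      and conf: "\<And>s i. s \<ge> T \<Longrightarrow> i \<notin> {prev_site N k, k} \<Longrightarrow> \<xi> s \<omega> i = \<xi> T \<omega> i"
      by blast
    let ?j = "prev_site N k"
    define a b where "a n = \<xi> (T + n) \<omega> k" and "b n = \<xi> (T + n) \<omega> ?j" for n
    have jk: "?j \<noteq> k" using distinct_sites[OF assms(1) k] by simp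
    have ab_step: "a (Suc n) + b (Suc n) = a n + b n + 1" for n
    proof -
      from elim(3) obtain i where i: "\<xi> (Suc (T + n)) \<omega> = inc (\<xi> (T + n) \<omega>) i" by blast
      have "i \<in> {?j, k}"
      proof (rule ccontr)
        assume "i \<notin> {?j, k}"
        then have "\<xi> (Suc (T + n)) \<omega> i = \<xi> (T + n) \<omega> i"
          using conf[of "Suc (T + n)" i] conf[of "T + n" i] by simp
        with i show False by (simp add: inc_def)
      qed
      then show ?thesis using i jk by (auto simp: a_def b_def inc_def)
    qed
    have ab: "a n + b n = a 0 + b 0 + n" for n
      by (induction n) (use ab_step in simp_all)
    have dev: "eventually (\<lambda>n. \<bar>(real (a n) - real (a 0)) - r k (\<xi> T \<omega>) * (real (b n) - real (b 0))\<bar> < \<delta> * real n) sequentially"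
      if \<delta>: "\<delta> > 0" for \<delta>
    proof -
      from \<delta> obtain m where m: "1 / real (Suc m) < \<delta>"
        by (rule nat_approx_posE)
      have "\<forall>s>T. \<xi> s \<omega> \<in> P k (\<xi> T \<omega>)" unfolding P_def using conf less_imp_le by blast
      then have "eventually (\<lambda>n. \<sigma> * D k (\<xi> T \<omega>) (\<xi> (T + n) \<omega>) < 1 / real (Suc m) * real n) sequentially"
        if "\<sigma> \<in> {1, -1}" for \<sigma>
        using elim(1)[rule_format, OF k that history_in[OF elim(4), of T] past_history[OF elim(4)], of m] by simp
      from this[OF insertI1] this[OF insertI2[OF singletonI]]
      have "eventually (\<lambda>n. \<bar>D k (\<xi> T \<omega>) (\<xi> (T + n) \<omega>)\<bar> < 1 / real (Suc m) * real n) sequentially"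
        by eventually_elim simp
      then show ?thesis
      proof eventually_elim
        case (elim n)
        also have "1 / real (Suc m) * real n \<le> \<delta> * real n"
          using m by (intro mult_right_mono) auto
        finally show ?case by (simp add: D_def a_def b_def)
      qed
    qed
    have r0: "r k (\<xi> T \<omega>) > 0" using \<beta> by (simp add: r_def)
    have lim: "(\<lambda>n. real (a n) / real (b n)) \<longlonglongrightarrow> r k (\<xi> T \<omega>)"
      "filterlim a at_top sequentially" "filterlim b at_top sequentially"
      by (rule ratio_from_deviation[OF r0 ab dev]; assumption)+
    have shift: "filterlim (\<lambda>t. f (T + t)) F sequentially \<longleftrightarrow> filterlim f F sequentially" for f :: "nat \<Rightarrow> nat" and F
      unfolding filterlim_iff add.commute[of T] by (simp only: eventually_sequentially_seg[of "\<lambda>n. P (f n)" T for P])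
    show ?case
    proof (intro bexI[of _ k] exI[of _ T] conjI allI impI)
      show "filterlim (\<lambda>t. \<xi> t \<omega> k) at_top sequentially"
        using lim(2) unfolding a_def by (rule shift[of "\<lambda>t. \<xi> t \<omega> k", THEN iffD1])
      show "filterlim (\<lambda>t. \<xi> t \<omega> ?j) at_top sequentially"
        using lim(3) unfolding b_def by (rule shift[of "\<lambda>t. \<xi> t \<omega> ?j", THEN iffD1])
      show "(\<lambda>t. real (\<xi> t \<omega> k) / real (\<xi> t \<omega> ?j))
          \<longlonglongrightarrow> \<beta> powi (int (\<xi> T \<omega> (next_site N k)) - int (\<xi> T \<omega> (prev_site N ?j)))"
      proof (rule LIMSEQ_offset[of _ T])
        show "(\<lambda>n. real (\<xi> (n + T) \<omega> k) / real (\<xi> (n + T) \<omega> ?j))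
          \<longlonglongrightarrow> \<beta> powi (int (\<xi> T \<omega> (next_site N k)) - int (\<xi> T \<omega> (prev_site N ?j)))"
          using lim(1) by (simp add: a_def b_def r_def add.commute)
      qed
    qed (fact conf k)+
  qed
qed

end

section \<open>Escape of the differences for \<open>\<beta> < 1\<close>\<close>

lemma periodic_sum_shift:
  fixes F :: "nat \<Rightarrow> real"
  assumes "\<And>m. F (m + L) = F m"
  shows "(\<Sum>m<L. F (m + j)) = (\<Sum>m<L. F m)"
proof (induction j)
  case (Suc j)
  have "(\<Sum>m<L. F (m + Suc j)) + F j = (\<Sum>m<Suc L. F (m + j))"
    by (subst sum.lessThan_Suc_shift) (simp add: add.commute)
  also have "\<dots> = (\<Sum>m<L. F (m + j)) + F j"
    using assms[of j] by (simp add: add.commute)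
  finally show ?case using Suc by simp
qed simp

text \<open>The windows tile \<open>3 * L\<close> consecutive positions, that is three full periods,
  whatever the residue of \<open>L\<close> modulo 3.\<close>

lemma periodic_sum_three:
  fixes Y :: "nat \<Rightarrow> real"
  assumes per: "\<And>m. Y (m + L) = Y m"
  shows "(\<Sum>k<L. Y (m + 3 * k) + Y (m + 3 * k + 1) + Y (m + 3 * k + 2)) = 3 * (\<Sum>l<L. Y l)"
proof -
  have "(\<Sum>k<n. Y (m + 3 * k) + Y (m + 3 * k + 1) + Y (m + 3 * k + 2)) = (\<Sum>l<3 * n. Y (m + l))" for n
    by (induction n) (simp_all add: numeral_3_eq_3 algebra_simps)
  also have "(\<Sum>l<3 * L. Y (m + l)) = 3 * (\<Sum>l<L. Y (l + m))"
  proof -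
    have "(\<Sum>l<n * L. Y (m + l)) = real n * (\<Sum>l<L. Y (l + m))" for n
    proof (induction n)
      case (Suc n)
      have perk: "Y (j + n * L) = Y j" for j
        by (induction n) (use per in \<open>simp_all add: add.assoc[symmetric] add.commute[of L]\<close>)
      have "(\<Sum>l<Suc n * L. Y (m + l)) = (\<Sum>l<n * L. Y (m + l)) + (\<Sum>l<L. Y (m + (l + n * L)))"
        using sum.atLeastLessThan_concat[of 0 "n * L" "Suc n * L" "\<lambda>l. Y (m + l)"]
          sum.shift_bounds_nat_ivl[of "\<lambda>l. Y (m + l)" 0 "n * L" L]
        by (simp add: atLeast0LessThan add.commute)
      also have "(\<Sum>l<L. Y (m + (l + n * L))) = (\<Sum>l<L. Y (l + m))"
        by (intro sum.cong refl) (simp add: perk add.assoc[symmetric] add.commute[of m])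
      finally show ?case using Suc by (simp add: algebra_simps)
    qed simp
    from this[of 3] show ?thesis by simp
  qed
  also have "(\<Sum>l<L. Y (l + m)) = (\<Sum>l<L. Y l)" by (rule periodic_sum_shift[of Y L, OF per])
  finally show ?thesis .
qed

text \<open>
  Averaging \<open>Y\<close> over the shifts by multiples of 3 changes each value only by a multiple of \<open>B\<close>
  because \<open>Y (p + 3) - Y p = e (p + 1) - e p\<close>, while the averaged sequence pairs to zero with \<open>e\<close>.
  This treats the period \<open>L\<close> uniformly, although for \<open>L\<close> divisible by 3 the map \<open>Y \<mapsto> e\<close> has a kernel.
\<close>

lemma periodic_form_bound:
  fixes Y :: "nat \<Rightarrow> real"
  assumes per: "\<And>m. Y (m + L) = Y m" and sum0: "(\<Sum>m<L. Y m) = 0" and L: "L > 0"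
    and e: "\<And>m. e m = Y m + Y (m + 1) + Y (m + 2)" and B: "\<And>m. \<bar>e m\<bar> \<le> B"
  shows "\<bar>\<Sum>m<L. Y (m + 1) * e m\<bar> \<le> 2 * B\<^sup>2 * (real L)\<^sup>2"
proof -
  have B0: "B \<ge> 0" using B[of 0] by linarith
  \<comment> \<open>Consecutive windows share two terms, so \<open>e (q + 1) - e q\<close> is
    \<open>Y (q + 3) - Y q\<close>, and each shift by 3 costs at most \<open>2 * B\<close>.\<close>
  have step3: "\<bar>Y p - Y (p + 3 * k)\<bar> \<le> 2 * B * real k" for p k
  proof (induction k)
    case (Suc k)
    define q where "q = p + 3 * k"
    have "Y (q + 3) - Y q = e (q + 1) - e q"
      by (simp add: e numeral_3_eq_3)
    then have "\<bar>Y p - Y (q + 3)\<bar> \<le> 2 * B * real k + 2 * B"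
      using Suc[folded q_def] B[of "q + 1"] B[of q] by linarith
    moreover have "p + 3 * Suc k = q + 3" by (simp add: q_def)
    moreover have "2 * B * real (Suc k) = 2 * B * real k + 2 * B" by (simp add: distrib_left)
    ultimately show ?case by (simp only:)
  qed simp
  \<comment> \<open>The three-term sum is symmetric under the cyclic pairing, so it can be moved
    from the factor \<open>e\<close> to the shifted factor. There the sum over \<open>k\<close>
    covers three periods of \<open>Y\<close> and vanishes by \<open>sum0\<close>.\<close>
  have zero: "(\<Sum>m<L. \<Sum>k<L. Y (m + 1 + 3 * k) * e m) = 0"
  proof -
    have "(\<Sum>m<L. Y (m + 1 + 3 * k) * e m)
      = (\<Sum>m<L. Y (m + 1) * (Y (m + 3 * k) + Y (m + 3 * k + 1) + Y (m + 3 * k + 2)))" for k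
    proof -
      have perk: "Y (m + L + c) = Y (m + c)" for m c
        using per[of "m + c"] by (simp add: ac_simps)
      have 1: "(\<Sum>m<L. Y (m + 1 + 1) * Y (m + 1 + 3 * k)) = (\<Sum>m<L. Y (m + 1) * Y (m + 3 * k))"
        by (rule periodic_sum_shift[of "\<lambda>m. Y (m + 1) * Y (m + 3 * k)" L 1]) (simp only: perk)
      have 2: "(\<Sum>m<L. Y (m + 1) * Y (m + 1 + (3 * k + 1))) = (\<Sum>m<L. Y m * Y (m + (3 * k + 1)))"
        by (rule periodic_sum_shift[of "\<lambda>m. Y m * Y (m + (3 * k + 1))" L 1]) (simp only: perk per)
      have "(\<Sum>m<L. Y (m + 1 + 3 * k) * e m) = (\<Sum>m<L. Y m * Y (m + (3 * k + 1)))
        + (\<Sum>m<L. Y (m + 1) * Y (m + 3 * k + 1)) + (\<Sum>m<L. Y (m + 1 + 1) * Y (m + 1 + 3 * k))"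
        unfolding sum.distrib[symmetric] by (intro sum.cong refl) (simp add: e algebra_simps)
      also have "\<dots> = (\<Sum>m<L. Y (m + 1) * Y (m + 1 + (3 * k + 1)))
        + (\<Sum>m<L. Y (m + 1) * Y (m + 3 * k + 1)) + (\<Sum>m<L. Y (m + 1) * Y (m + 3 * k))"
        by (simp only: 1 2)
      also have "\<dots> = (\<Sum>m<L. Y (m + 1) * (Y (m + 3 * k) + Y (m + 3 * k + 1) + Y (m + 3 * k + 2)))"
        unfolding sum.distrib[symmetric] by (intro sum.cong refl) (simp add: algebra_simps)
      finally show ?thesis .
    qed
    then have "(\<Sum>m<L. \<Sum>k<L. Y (m + 1 + 3 * k) * e m)
      = (\<Sum>m<L. \<Sum>k<L. Y (m + 1) * (Y (m + 3 * k) + Y (m + 3 * k + 1) + Y (m + 3 * k + 2)))"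
      by (subst (1 2) sum.swap) simp
    also have "\<dots> = 0"
      unfolding sum_distrib_left[symmetric] periodic_sum_three[of Y L, OF per] sum0 by simp
    finally show ?thesis .
  qed
  have "real L * (\<Sum>m<L. Y (m + 1) * e m) = (\<Sum>m<L. \<Sum>k<L. Y (m + 1) * e m)"
    by (simp add: sum_distrib_left)
  also have "\<dots> = (\<Sum>m<L. \<Sum>k<L. (Y (m + 1) - Y (m + 1 + 3 * k)) * e m)"
    using zero by (simp add: left_diff_distrib sum_subtractf)
  finally have "\<bar>real L * (\<Sum>m<L. Y (m + 1) * e m)\<bar> \<le> (\<Sum>m<L. \<Sum>k<L. \<bar>(Y (m + 1) - Y (m + 1 + 3 * k)) * e m\<bar>)"
    by (simp only:) (intro order_trans[OF sum_abs] sum_mono, rule order_refl)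
  also have "\<dots> \<le> (\<Sum>m<L. \<Sum>k<L. (2 * B * real L) * B)"
  proof (intro sum_mono)
    fix m k assume "k \<in> {..<L}"
    then have "2 * B * real k \<le> 2 * B * real L" using B0 by (intro mult_left_mono) auto
    then show "\<bar>(Y (m + 1) - Y (m + 1 + 3 * k)) * e m\<bar> \<le> (2 * B * real L) * B"
      unfolding abs_mult using step3[of "m + 1" k] B[of m] by (intro mult_mono) auto
  qed
  also have "\<dots> = real L * (2 * B\<^sup>2 * (real L)\<^sup>2)"
    by (simp add: power2_eq_square)
  finally show ?thesis
    using L by (simp add: abs_mult)
qed

section \<open>The quadratic form and its change along the chain\<close>

definition nbr_sum :: "nat \<Rightarrow> (nat \<Rightarrow> real) \<Rightarrow> nat \<Rightarrow> real" where
  "nbr_sum N f i = (\<Sum>j\<in>neighbourhood N i. f j)"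

text \<open>The coefficient is dictated by invariance under constants: each neighbourhood has three
  sites, so on a constant \<open>c\<close> both terms equal
  \<open>3 * c\<^sup>2 * (real N + 1)\<close>.\<close>

definition form :: "nat \<Rightarrow> (nat \<Rightarrow> real) \<Rightarrow> real" where
  "form N f = (\<Sum>i\<in>sites N. f i * nbr_sum N f i) - 3 * (\<Sum>i\<in>sites N. f i)\<^sup>2 / (real N + 1)"

lemma nbr_sum_eq:
  assumes "N \<ge> 3" "k \<in> sites N"
  shows "nbr_sum N f k = f (prev_site N k) + f k + f (next_site N k)"
  using distinct_sites[OF assms] by (simp add: nbr_sum_def neighbourhood_def)

lemma nbr_sum_of_nat: "nbr_sum N (\<lambda>i. real (x i)) i = real (potential N x i)"
  by (simp add: nbr_sum_def potential_def)

lemma sum_nbr_indicator: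
  assumes "j \<in> sites N"
  shows "(\<Sum>i\<in>sites N. f i * (if j \<in> neighbourhood N i then 1 else 0)) = nbr_sum N f j"
proof -
  have "(\<Sum>i\<in>sites N. f i * (if j \<in> neighbourhood N i then 1 else 0))
    = (\<Sum>i\<in>sites N. if i \<in> neighbourhood N j then f i else 0)"
    using assms neighbourhood_sym by (intro sum.cong) auto
  also have "\<dots> = (\<Sum>i\<in>sites N \<inter> neighbourhood N j. f i)"
    by (simp add: sum.inter_restrict)
  also have "sites N \<inter> neighbourhood N j = neighbourhood N j"
    using neighbourhood_subset[OF assms] by blast
  finally show ?thesis by (simp add: nbr_sum_def)
qed

lemma sum_nbr_sum:
  assumes "N \<ge> 3"
  shows "(\<Sum>i\<in>sites N. nbr_sum N f i) = 3 * (\<Sum>i\<in>sites N. f i)"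
proof -
  have bij: "bij_betw (next_site N) (sites N) (sites N)" "bij_betw (prev_site N) (sites N) (sites N)"
    by (rule bij_betwI[where g="prev_site N"]; auto simp: next_site_in prev_site_in prev_next_site next_prev_site)
      (rule bij_betwI[where g="next_site N"]; auto simp: next_site_in prev_site_in prev_next_site next_prev_site)
  have "(\<Sum>i\<in>sites N. nbr_sum N f i) = (\<Sum>i\<in>sites N. f (prev_site N i)) + (\<Sum>i\<in>sites N. f i) + (\<Sum>i\<in>sites N. f (next_site N i))"
    using assms by (simp add: nbr_sum_eq sum.distrib)
  then show ?thesis
    using sum.reindex_bij_betw[OF bij(1), of f] sum.reindex_bij_betw[OF bij(2), of f] by simp
qed

lemma form_cong: "(\<And>i. i \<in> sites N \<Longrightarrow> f i = g i) \<Longrightarrow> form N f = form N g"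
  unfolding form_def nbr_sum_def using neighbourhood_subset
  by (intro arg_cong2[where f="(-)"] arg_cong2[where f="(*)"] arg_cong2[where f="(/)"] arg_cong2[where f="(^)"]
      sum.cong refl) (auto dest: subsetD)

lemma form_line:
  "\<exists>b. \<forall>c. form N (\<lambda>i. f i + c * g i) = form N f + c * b + c\<^sup>2 * form N g"
proof -
  define b where "b = (\<Sum>i\<in>sites N. f i * nbr_sum N g i + g i * nbr_sum N f i)
    - 6 * (\<Sum>i\<in>sites N. f i) * (\<Sum>i\<in>sites N. g i) / (real N + 1)"
  have nb: "nbr_sum N (\<lambda>i. f i + c * g i) i = nbr_sum N f i + c * nbr_sum N g i" for c i
    by (simp add: nbr_sum_def sum.distrib sum_distrib_left)
  have "form N (\<lambda>i. f i + c * g i) = form N f + c * b + c\<^sup>2 * form N g" for c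
  proof -
    define F G where "F = (\<Sum>i\<in>sites N. f i)" and "G = (\<Sum>i\<in>sites N. g i)"
    have "(\<Sum>i\<in>sites N. (f i + c * g i) * nbr_sum N (\<lambda>i. f i + c * g i) i)
      = (\<Sum>i\<in>sites N. f i * nbr_sum N f i) + c * (\<Sum>i\<in>sites N. f i * nbr_sum N g i + g i * nbr_sum N f i)
        + c\<^sup>2 * (\<Sum>i\<in>sites N. g i * nbr_sum N g i)"
      unfolding nb sum_distrib_left sum.distrib[symmetric]
      by (intro sum.cong refl) (simp add: algebra_simps power2_eq_square)
    moreover have "(\<Sum>i\<in>sites N. f i + c * g i) = F + c * G"
      by (simp add: F_def G_def sum.distrib sum_distrib_left)
    moreover have "3 * (F + c * G)\<^sup>2 / (real N + 1)
      = 3 * F\<^sup>2 / (real N + 1) + c * (6 * F * G / (real N + 1)) + c\<^sup>2 * (3 * G\<^sup>2 / (real N + 1))"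
      by (simp add: add_divide_distrib[symmetric] algebra_simps power2_eq_square)
    ultimately show ?thesis
      unfolding form_def b_def F_def[symmetric] G_def[symmetric] by (simp only:) (simp add: algebra_simps)
  qed
  then show ?thesis by blast
qed

lemma form_shift:
  assumes "N \<ge> 3"
  shows "form N (\<lambda>i. f i + c) = form N f"
proof -
  define F where "F = (\<Sum>i\<in>sites N. f i)"
  have card: "card (neighbourhood N i) = 3" if "i \<in> sites N" for i
    using distinct_sites[OF assms that] by (simp add: neighbourhood_def)
  have nb: "nbr_sum N (\<lambda>i. f i + c) i = nbr_sum N f i + 3 * c" if "i \<in> sites N" for i
    using card[OF that] by (simp add: nbr_sum_def sum.distrib)
  have "(\<Sum>i\<in>sites N. (f i + c) * nbr_sum N (\<lambda>i. f i + c) i)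
    = (\<Sum>i\<in>sites N. f i * nbr_sum N f i + 3 * c * f i + c * nbr_sum N f i + 3 * c\<^sup>2)"
  proof (intro sum.cong refl)
    fix i assume i: "i \<in> sites N"
    show "(f i + c) * nbr_sum N (\<lambda>i. f i + c) i
      = f i * nbr_sum N f i + 3 * c * f i + c * nbr_sum N f i + 3 * c\<^sup>2"
      unfolding nb[OF i] by (simp add: algebra_simps power2_eq_square)
  qed
  also have "\<dots> = (\<Sum>i\<in>sites N. f i * nbr_sum N f i) + 3 * c * F + c * (3 * F) + 3 * c\<^sup>2 * (real N + 1)"
    by (simp add: sum.distrib sum_distrib_left[symmetric] sum_nbr_sum[OF assms] F_def)
  finally have 1: "(\<Sum>i\<in>sites N. (f i + c) * nbr_sum N (\<lambda>i. f i + c) i) = \<dots>" .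
  have 2: "(\<Sum>i\<in>sites N. f i + c) = F + c * (real N + 1)"
    by (simp add: sum.distrib F_def algebra_simps)
  have "3 * (F + c * (real N + 1))\<^sup>2 / (real N + 1) = 3 * F\<^sup>2 / (real N + 1) + 6 * c * F + 3 * c\<^sup>2 * (real N + 1)"
    by (simp add: field_simps power2_eq_square)
  then show ?thesis unfolding form_def 1 2 F_def[symmetric] by simp
qed

text \<open>The linear term is twice the deviation of the potential at \<open>i\<close> from the
  mean potential, and the constant is the form of a unit vector. Halving the form thus isolates the
  potential that appears in the transition weight.\<close>

lemma form_inc:
  assumes "N \<ge> 3" "i \<in> sites N"
  shows "form N (\<lambda>j. real (inc x i j)) = form N (\<lambda>j. real (x j))
    + 2 * (real (potential N x i) - 3 * (\<Sum>j\<in>sites N. real (x j)) / (real N + 1)) + (1 - 3 / (real N + 1))"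
proof -
  let ?\<delta> = "\<lambda>j. if j = i then 1 else 0 :: real"
  let ?x = "\<lambda>j. real (x j)"
  have inc: "real (inc x i j) = ?x j + ?\<delta> j" for j by (simp add: inc_def)
  have nb\<delta>: "nbr_sum N ?\<delta> j = (if i \<in> neighbourhood N j then 1 else 0)" for j
    by (simp add: nbr_sum_def)
  have nb: "nbr_sum N (\<lambda>j. ?x j + ?\<delta> j) j = nbr_sum N ?x j + (if i \<in> neighbourhood N j then 1 else 0)" for j
    using nb\<delta>[of j] by (simp add: nbr_sum_def sum.distrib)
  have self: "i \<in> neighbourhood N i" by (simp add: neighbourhood_def)
  have "(\<Sum>j\<in>sites N. (?x j + ?\<delta> j) * nbr_sum N (\<lambda>j. ?x j + ?\<delta> j) j)
    = (\<Sum>j\<in>sites N. ?x j * nbr_sum N ?x j + ?x j * (if i \<in> neighbourhood N j then 1 else 0)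
        + (if j = i then nbr_sum N ?x i + 1 else 0))"
    unfolding nb using self by (intro sum.cong refl) (auto simp: algebra_simps)
  also have "\<dots> = (\<Sum>j\<in>sites N. ?x j * nbr_sum N ?x j) + nbr_sum N ?x i + (nbr_sum N ?x i + 1)"
    unfolding sum.distrib sum_nbr_indicator[OF assms(2)] using assms(2) by simp
  finally have 1: "(\<Sum>j\<in>sites N. (?x j + ?\<delta> j) * nbr_sum N (\<lambda>j. ?x j + ?\<delta> j) j)
    = (\<Sum>j\<in>sites N. ?x j * nbr_sum N ?x j) + 2 * real (potential N x i) + 1"
    by (simp add: nbr_sum_of_nat)
  define S where "S = (\<Sum>j\<in>sites N. ?x j)"
  have 2: "(\<Sum>j\<in>sites N. ?x j + ?\<delta> j) = S + 1"
    using assms(2) by (simp add: sum.distrib S_def)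
  have "3 * (S + 1)\<^sup>2 / (real N + 1) = 3 * S\<^sup>2 / (real N + 1) + 2 * (3 * S / (real N + 1)) + 3 / (real N + 1)"
    by (simp add: add_divide_distrib[symmetric] power2_eq_square algebra_simps)
  then show ?thesis
    unfolding inc form_def 1 2 S_def[symmetric] by (simp add: algebra_simps)
qed

text \<open>The deviations of the potentials from their mean sum to zero, so the lower bound
  \<open>- B\<close> at all sites forces the upper bound \<open>B * real N\<close>. Read cyclically,
  the centred \<open>f\<close> then meets the hypotheses of \<open>periodic_form_bound\<close>. In
  contrapositive form, a very negative form forces a potential far below the mean.\<close>

lemma form_lower_bound:
  assumes "N \<ge> 3" "B \<ge> 0"
    and d: "\<And>j. j \<in> sites N \<Longrightarrow> nbr_sum N f j - 3 * (\<Sum>i\<in>sites N. f i) / (real N + 1) \<ge> - B"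
  shows "form N f \<ge> - (2 * (B * (real N + 1))\<^sup>2 * (real N + 1)\<^sup>2)"
proof -
  define L where "L = N + 1"
  define s where "s = (\<Sum>i\<in>sites N. f i) / (real N + 1)"
  define site where "site m = Suc (m mod L)" for m
  define g where "g i = f i + (- s)" for i
  define Y where "Y m = g (site m)" for m
  define e where "e m = Y m + Y (m + 1) + Y (m + 2)" for m
  have L: "L > 0" by (simp add: L_def)
  have site_in: "site m \<in> sites N" for m
    using mod_less_divisor[OF L, of m] by (simp add: site_def sites_def L_def less_Suc_eq_le)
  have site_Suc: "site (Suc m) = next_site N (site m)" for m
    by (auto simp: site_def next_site_def L_def mod_Suc)
  have sum_site: "(\<Sum>m<L. h (site m)) = (\<Sum>i\<in>sites N. h i)" for h :: "nat \<Rightarrow> real"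
  proof -
    have "(\<Sum>m<L. h (site m)) = (\<Sum>m<L. h (Suc m))"
      by (intro sum.cong) (auto simp: site_def)
    also have "\<dots> = (\<Sum>i\<in>sites N. h i)"
      unfolding sites_def L_def using sum.atLeast1_atMost_eq[of h "N + 1"] by simp
    finally show ?thesis .
  qed
  have per: "Y (m + L) = Y m" for m by (simp add: Y_def site_def)
  have sum0: "(\<Sum>i\<in>sites N. g i) = 0"
  proof -
    have "(\<Sum>i\<in>sites N. g i) = (\<Sum>i\<in>sites N. f i) - (real N + 1) * s"
      by (simp add: g_def sum_subtractf algebra_simps)
    then show ?thesis by (simp add: s_def)
  qed
  \<comment> \<open>The window of \<open>e m\<close> starts at \<open>m\<close>, so its centre has
    index \<open>m + 1\<close>.\<close>
  have e_eq: "e m = nbr_sum N g (site (m + 1))" for m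
    using nbr_sum_eq[OF assms(1) site_in[of "Suc m"], of g] prev_next_site[OF site_in[of m]]
    by (simp add: e_def Y_def site_Suc)
  have nb: "nbr_sum N g j = nbr_sum N f j - 3 * s" if "j \<in> sites N" for j
    using nbr_sum_eq[OF assms(1) that] by (simp add: g_def)
  have lower: "nbr_sum N g j \<ge> - B" if "j \<in> sites N" for j
    using d[OF that] nb[OF that] by (simp add: s_def)
  have sum_nb: "(\<Sum>j\<in>sites N. nbr_sum N g j) = 0"
    by (simp add: sum_nbr_sum[OF assms(1)] sum0)
  have upper: "nbr_sum N g j \<le> B * real N" if "j \<in> sites N" for j
  proof -
    have "(\<Sum>i\<in>sites N - {j}. - B) \<le> (\<Sum>i\<in>sites N - {j}. nbr_sum N g i)"
      using lower by (intro sum_mono) auto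
    moreover have "(\<Sum>i\<in>sites N. nbr_sum N g i) = nbr_sum N g j + (\<Sum>i\<in>sites N - {j}. nbr_sum N g i)"
      using that by (intro sum.remove) auto
    moreover have "card (sites N - {j}) = N" using that by simp
    ultimately show ?thesis using sum_nb by (simp add: mult.commute)
  qed
  have abs: "\<bar>e m\<bar> \<le> B * (real N + 1)" for m
    using lower[OF site_in[of "m + 1"]] upper[OF site_in[of "m + 1"]] assms(2) unfolding e_eq
    by (simp add: abs_le_iff distrib_left) (smt (verit) mult_nonneg_nonneg of_nat_0_le_iff)
  have "form N f = form N g" unfolding g_def by (rule form_shift[OF assms(1), symmetric])
  also have "\<dots> = (\<Sum>i\<in>sites N. g i * nbr_sum N g i)" by (simp add: form_def sum0)
  also have "\<dots> = (\<Sum>m<L. Y m * nbr_sum N g (site m))" by (simp add: sum_site[symmetric] Y_def)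
  also have "\<dots> = (\<Sum>m<L. Y (m + 1) * nbr_sum N g (site (m + 1)))"
    by (rule periodic_sum_shift[symmetric]) (simp add: per site_def)
  also have "\<dots> = (\<Sum>m<L. Y (m + 1) * e m)" by (simp add: e_eq)
  finally have "form N f = (\<Sum>m<L. Y (m + 1) * e m)" .
  moreover have "\<bar>\<Sum>m<L. Y (m + 1) * e m\<bar> \<le> 2 * (B * (real N + 1))\<^sup>2 * (real L)\<^sup>2"
    using sum0 sum_site[of g] by (intro periodic_form_bound[OF per _ L e_def abs]) (simp add: Y_def)
  ultimately show ?thesis by (simp add: L_def add.commute)
qed

text \<open>By \<open>form_inc\<close> a step at \<open>i\<close> brings in the inverse of the
  weight of \<open>i\<close>, which cancels the numerator of \<open>step_prob\<close>. All
  \<open>N + 1\<close> steps contribute equally, and only the total weight stays in the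
  denominator.\<close>

lemma killed_form_powr:
  assumes "N \<ge> 3" "0 < \<beta>"
  shows "killed N \<beta> UNIV (\<lambda>y. \<beta> powr (- form N (\<lambda>i. real (y i)) / 2)) x
    = \<beta> powr (- form N (\<lambda>i. real (x i)) / 2) * ((real N + 1) * \<beta> powr (- (1 - 3 / (real N + 1)) / 2)
      * \<beta> powr (3 * (\<Sum>j\<in>sites N. real (x j)) / (real N + 1)) / (\<Sum>j\<in>sites N. \<beta> ^ potential N x j))"
proof -
  define V where "V y = \<beta> powr (- form N (\<lambda>i. real (y i)) / 2)" for y :: "nat \<Rightarrow> nat"
  define s where "s = 3 * (\<Sum>j\<in>sites N. real (x j)) / (real N + 1)"
  define c where "c = - (1 - 3 / (real N + 1)) / 2"
  define W where "W = (\<Sum>j\<in>sites N. \<beta> ^ potential N x j)"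
  have "step_prob N \<beta> x i * V (inc x i) = V x * (\<beta> powr c * \<beta> powr s / W)" if "i \<in> sites N" for i
  proof -
    have "- form N (\<lambda>j. real (inc x i j)) / 2
      = - form N (\<lambda>i. real (x i)) / 2 + (c + s) - real (potential N x i)"
      unfolding form_inc[OF assms(1) that] s_def[symmetric] by (simp add: c_def field_simps)
    then have "V (inc x i) = V x * (\<beta> powr c * \<beta> powr s) / \<beta> ^ potential N x i"
      using assms(2) by (simp only: V_def powr_diff powr_add powr_realpow)
    then show ?thesis
      using assms(2) by (simp add: step_prob_def W_def)
  qed
  then have "killed N \<beta> UNIV V x = (\<Sum>i\<in>sites N. V x * (\<beta> powr c * \<beta> powr s / W))"
    unfolding killed_def by (intro sum.cong) auto
  then show ?thesis
    by (simp add: V_def[abs_def] c_def s_def W_def add.commute)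
qed

text \<open>
  For \<open>\<beta> < 1\<close> the function \<open>\<beta> powr (- form / 2)\<close> is superharmonic wherever some site has potential
  far below average, and by \<open>form_lower_bound\<close> this holds wherever the form is very negative.
\<close>

lemma form_powr_superharmonic:
  assumes "N \<ge> 3" "0 < \<beta>" "\<beta> < 1"
  shows "\<exists>q. \<forall>x. form N (\<lambda>i. real (x i)) < q \<longrightarrow>
    killed N \<beta> UNIV (\<lambda>y. \<beta> powr (- form N (\<lambda>i. real (y i)) / 2)) x \<le> \<beta> powr (- form N (\<lambda>i. real (x i)) / 2)"
proof -
  define K where "K = (real N + 1) * \<beta> powr (- (1 - 3 / (real N + 1)) / 2)"
  \<comment> \<open>\<open>\<beta> powr (- B)\<close> is at least \<open>K\<close>, so a single site
    with potential at most \<open>s - B\<close> gives total weight at least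
    \<open>K * \<beta> powr s\<close>. The maximum with 0 provides the sign required by
    \<open>form_lower_bound\<close>.\<close>
  define B where "B = max 0 (- log \<beta> K)"
  have K: "K > 0" using assms(2) by (simp add: K_def)
  have "\<beta> powr (- B) \<ge> \<beta> powr (log \<beta> K)"
    using assms by (intro powr_mono') (auto simp: B_def)
  then have B: "\<beta> powr (- B) \<ge> K" using assms K by simp
  show ?thesis
  proof (intro exI[of _ "- (2 * (B * (real N + 1))\<^sup>2 * (real N + 1)\<^sup>2)"] allI impI)
    fix x :: "nat \<Rightarrow> nat"
    let ?V = "\<beta> powr (- form N (\<lambda>i. real (x i)) / 2)"
    assume low: "form N (\<lambda>i. real (x i)) < - (2 * (B * (real N + 1))\<^sup>2 * (real N + 1)\<^sup>2)"
    define s where "s = 3 * (\<Sum>j\<in>sites N. real (x j)) / (real N + 1)"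
    define W where "W = (\<Sum>j\<in>sites N. \<beta> ^ potential N x j)"
    have "\<exists>j\<in>sites N. real (potential N x j) - s < - B"
    proof (rule ccontr)
      assume "\<not> ?thesis"
      then have "nbr_sum N (\<lambda>i. real (x i)) j - s \<ge> - B" if "j \<in> sites N" for j
        using that by (simp add: nbr_sum_of_nat not_less)
      from form_lower_bound[OF assms(1) _ this[unfolded s_def]] low show False
        by (simp add: B_def)
    qed
    then obtain j where j: "j \<in> sites N" "real (potential N x j) \<le> s - B" by force
    have "K * \<beta> powr s \<le> \<beta> powr (- B) * \<beta> powr s" using B by (intro mult_right_mono) auto
    also have "\<dots> = \<beta> powr (s - B)" by (simp add: powr_add[symmetric])
    also have "\<dots> \<le> \<beta> powr real (potential N x j)"
      using assms j(2) by (intro powr_mono') auto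
    also have "\<dots> = \<beta> ^ potential N x j" using assms(2) by (simp add: powr_realpow)
    also have "\<dots> \<le> W"
      unfolding W_def using assms(2) j(1) by (intro member_le_sum) auto
    finally have "K * \<beta> powr s / W \<le> 1"
      using weight_sum_pos[OF assms(2), of "potential N x" N] by (simp add: W_def)
    then have "?V * (K * \<beta> powr s / W) \<le> ?V" by (intro mult_left_le) auto
    then show "killed N \<beta> UNIV (\<lambda>y. \<beta> powr (- form N (\<lambda>i. real (y i)) / 2)) x \<le> ?V"
      unfolding killed_form_powr[OF assms(1,2)] K_def s_def W_def .
  qed
qed

text \<open>Optional stopping written with a subsolution: one minus \<open>V\<close> relative to its
  value at level \<open>q\<close>, cut off at 0. It vanishes where the form is at least
  \<open>q\<close>, so killing outside \<open>S\<close> loses nothing, and two units below the level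
  the quotient is at most \<beta>.\<close>

lemma stay_low_form:
  assumes "N \<ge> 3" "0 < \<beta>" "\<beta> < 1"
    and super: "\<And>x. form N (\<lambda>i. real (x i)) < q \<Longrightarrow>
      killed N \<beta> UNIV (\<lambda>y. \<beta> powr (- form N (\<lambda>i. real (y i)) / 2)) x \<le> \<beta> powr (- form N (\<lambda>i. real (x i)) / 2)"
    and S: "\<And>x. form N (\<lambda>i. real (x i)) < q \<Longrightarrow> x \<in> S" and y: "form N (\<lambda>i. real (y i)) \<le> q - 2"
  shows "1 - \<beta> \<le> (killed N \<beta> S ^^ n) (\<lambda>_. 1) y"
proof -
  let ?Q = "\<lambda>x :: nat \<Rightarrow> nat. form N (\<lambda>i. real (x i))"
  define V where "V x = \<beta> powr (- ?Q x / 2)" for x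
  define h where "h x = max 0 (1 - V x / \<beta> powr (- q / 2))" for x
  have h_zero: "h x = 0" if "\<not> ?Q x < q" for x
  proof -
    have "\<beta> powr (- q / 2) \<le> V x" unfolding V_def using assms that by (intro powr_mono') auto
    then show ?thesis using assms(2) by (simp add: h_def le_divide_eq)
  qed
  have sub: "h x \<le> killed N \<beta> S h x" for x
  proof (cases "?Q x < q")
    case True
    have V1: "V x / \<beta> powr (- q / 2) \<le> 1"
    proof -
      have "V x \<le> \<beta> powr (- q / 2)" unfolding V_def using assms True by (intro powr_mono') auto
      then show ?thesis using assms(2) by simp
    qed
    have "h x = 1 - V x / \<beta> powr (- q / 2)" using V1 by (simp add: h_def)
    also have "\<dots> \<le> 1 - killed N \<beta> UNIV V x / \<beta> powr (- q / 2)"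
      using super[OF True] by (intro diff_left_mono divide_right_mono) (simp_all add: V_def[abs_def])
    also have "\<dots> = killed N \<beta> UNIV (\<lambda>y. 1 - V y / \<beta> powr (- q / 2)) x"
      using sum_step_prob[OF assms(2), of N x]
      by (simp add: killed_def right_diff_distrib sum_subtractf sum_divide_distrib)
    also have "\<dots> \<le> killed N \<beta> UNIV h x"
      using assms(2) by (intro killed_mono) (auto simp: h_def)
    also have "\<dots> = killed N \<beta> S h x"
      unfolding killed_def using S h_zero by (intro sum.cong refl) (auto split: split_indicator)
    finally show ?thesis .
  next
    case False
    have "0 \<le> killed N \<beta> S h x"
      using killed_funpow_nonneg[OF assms(2), where f=h and N=N and S=S and n=1 and x=x] by (simp add: h_def)
    then show ?thesis by (simp add: h_zero[OF False])
  qed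
  have "1 - \<beta> \<le> h y"
  proof -
    have "V y \<le> \<beta> powr (1 + - q / 2)" unfolding V_def using assms y by (intro powr_mono') auto
    also have "\<dots> = \<beta> * \<beta> powr (- q / 2)" using assms(2) by (simp only: powr_add powr_one less_imp_le)
    finally have "V y / \<beta> powr (- q / 2) \<le> \<beta>" using assms(2) by (simp add: divide_le_eq)
    then show ?thesis unfolding h_def by linarith
  qed
  also have "h y \<le> (killed N \<beta> S ^^ n) (\<lambda>_. 1) y"
    using assms(2) y by (intro subsolution_le_stay sub S) (auto simp: h_def V_def)
  finally show ?thesis .
qed

text \<open>Up to a constant this is \<open>e\<^sub>1 - e\<^sub>2 + e\<^sub>3\<close>, whose form is \<open>-1 - 3 / (N + 1)\<close>.\<close>

definition tilt :: "nat \<Rightarrow> nat" where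
  "tilt i = (if i = 1 \<or> i = 3 then 2 else if i = 2 then 0 else 1)"

lemma form_tilt:
  assumes "N \<ge> 3"
  shows "form N (\<lambda>i. real (tilt i)) < 0"
proof -
  let ?v = "\<lambda>i. real (tilt i)"
  let ?I = "\<lambda>j i. if j \<in> neighbourhood N i then 1 else 0 :: real"
  have in_sites: "1 \<in> sites N" "2 \<in> sites N" "3 \<in> sites N" using assms by (auto simp: sites_def)
  have v: "?v i = 1 + (if i = 1 then 1 else 0) - (if i = 2 then 1 else 0) + (if i = 3 then 1 else 0)" for i
    by (simp add: tilt_def)
  have sum: "(\<Sum>i\<in>sites N. ?v i) = real N + 2"
    unfolding v sum.distrib sum_subtractf using in_sites by simp
  have card: "card (neighbourhood N i) = 3" if "i \<in> sites N" for i
    using distinct_sites[OF assms that] by (simp add: neighbourhood_def)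
  have nb: "nbr_sum N ?v i = 3 + ?I 1 i - ?I 2 i + ?I 3 i" if "i \<in> sites N" for i
    unfolding nbr_sum_def v sum.distrib sum_subtractf using card[OF that] by simp
  \<comment> \<open>\<open>N \<ge> 3\<close> keeps sites 1 and 3 non-adjacent, so their neighbours
    other than site 2 have tilt 1.\<close>
  have "nbr_sum N ?v 1 = 3" "nbr_sum N ?v 2 = 4" "nbr_sum N ?v 3 = 3"
    unfolding nbr_sum_eq[OF assms in_sites(1)] nbr_sum_eq[OF assms in_sites(2)]
      nbr_sum_eq[OF assms in_sites(3)] using assms by (simp_all add: prev_site_def next_site_def tilt_def)
  moreover have "(\<Sum>i\<in>sites N. ?v i * nbr_sum N ?v i)
    = (\<Sum>i\<in>sites N. 3 * ?v i + ?v i * ?I 1 i - ?v i * ?I 2 i + ?v i * ?I 3 i)"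
    by (intro sum.cong refl) (simp add: nb algebra_simps)
  ultimately have Q: "(\<Sum>i\<in>sites N. ?v i * nbr_sum N ?v i) = 3 * (real N + 2) + 2"
    unfolding sum.distrib sum_subtractf sum_nbr_indicator[OF in_sites(1)]
      sum_nbr_indicator[OF in_sites(2)] sum_nbr_indicator[OF in_sites(3)] sum_distrib_left[symmetric] sum
    by simp
  show ?thesis
    unfolding form_def sum Q by (simp add: field_simps power2_eq_square)
qed

text \<open>Along multiples of \<open>tilt\<close> the form is a quadratic polynomial with negative
  leading coefficient. Natural multiples are taken because they are to be reached by growth.\<close>

lemma form_tilt_unbounded:
  assumes "N \<ge> 3"
  shows "\<exists>m::nat. form N (\<lambda>i. f i + real m * real (tilt i)) \<le> q"
proof -
  obtain b where b: "\<And>c. form N (\<lambda>i. f i + c * real (tilt i)) = form N f + c * b + c\<^sup>2 * form N (\<lambda>i. real (tilt i))"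
    using form_line[of N f "\<lambda>i. real (tilt i)"] by blast
  define a where "a = - form N (\<lambda>i. real (tilt i))"
  have a: "a > 0" using form_tilt[OF assms] by (simp add: a_def)
  \<comment> \<open>The quotient lets \<open>a * real m\<close> dominate the linear coefficient and
    the gap to \<open>q\<close>; the summand 1 ensures \<open>1 \<le> real m\<close>.\<close>
  obtain m :: nat where m: "real m \<ge> (\<bar>b\<bar> + \<bar>form N f - q\<bar>) / a + 1"
    using real_arch_simple by blast
  have "a * ((\<bar>b\<bar> + \<bar>form N f - q\<bar>) / a + 1) \<le> a * real m" using a m by (intro mult_left_mono) auto
  moreover have "a * ((\<bar>b\<bar> + \<bar>form N f - q\<bar>) / a + 1) = \<bar>b\<bar> + \<bar>form N f - q\<bar> + a"
    using a by (simp add: field_simps)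
  ultimately have "\<bar>b\<bar> + \<bar>form N f - q\<bar> \<le> a * real m" using a by linarith
  then have "real m * (\<bar>b\<bar> + \<bar>form N f - q\<bar>) \<le> real m * (a * real m)" by (intro mult_left_mono) auto
  moreover have "real m * b \<le> real m * \<bar>b\<bar>" by (intro mult_left_mono) auto
  moreover have "\<bar>form N f - q\<bar> * 1 \<le> \<bar>form N f - q\<bar> * real m"
  proof (intro mult_left_mono)
    have "0 \<le> (\<bar>b\<bar> + \<bar>form N f - q\<bar>) / a" using a by simp
    with m show "1 \<le> real m" by linarith
  qed auto
  ultimately have "form N f + real m * b - real m * (a * real m) \<le> q"
    by (simp add: distrib_left mult.commute)
  then show ?thesis
    unfolding b by (intro exI[of _ m]) (simp add: a_def power2_eq_square algebra_simps)
qed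

text \<open>Induction on the number of increments missing from \<open>w\<close> to \<open>y\<close>:
  any site below its target may grow next, at the cost of a factor \<delta>. Only configurations
  other than \<open>x\<close> must lie in \<open>S\<close>, so the path may start at a forbidden
  \<open>x\<close>.\<close>

lemma stay_along_path:
  assumes "\<beta> > 0" "0 \<le> \<delta>" "\<delta> \<le> 1" "0 \<le> \<eta>" "\<eta> \<le> 1"
    and step: "\<And>w i. (\<And>a. x a \<le> w a \<and> w a \<le> y a) \<Longrightarrow> i \<in> sites N \<Longrightarrow> \<delta> \<le> step_prob N \<beta> w i"
    and S: "\<And>w. (\<And>a. x a \<le> w a \<and> w a \<le> y a) \<Longrightarrow> w \<noteq> x \<Longrightarrow> w \<in> S"
    and off: "\<And>a. a \<notin> sites N \<Longrightarrow> y a = x a"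
    and target: "\<And>n. \<eta> \<le> (killed N \<beta> S ^^ n) (\<lambda>_. 1) y"
    and w: "\<And>a. x a \<le> w a \<and> w a \<le> y a" and k: "(\<Sum>a\<in>sites N. y a - w a) = k"
  shows "\<delta> ^ k * \<eta> \<le> (killed N \<beta> S ^^ n) (\<lambda>_. 1) w"
  using w k
proof (induction k arbitrary: w n)
  case 0
  have "w a = y a" for a
  proof (cases "a \<in> sites N")
    case True
    then have "y a - w a = 0" using "0.prems"(2) by simp
    with "0.prems"(1)[of a] show ?thesis by linarith
  next
    case False
    with off[OF False] "0.prems"(1)[of a] show ?thesis by linarith
  qed
  then have "w = y" by auto
  then show ?case using target by simp
next
  case (Suc k)
  have "(\<Sum>a\<in>sites N. y a - w a) \<noteq> 0" using Suc.prems(2) by simp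
  then obtain i where i: "i \<in> sites N" "y i - w i \<noteq> 0"
    by (meson sum.not_neutral_contains_not_neutral)
  have bounds: "x a \<le> inc w i a \<and> inc w i a \<le> y a" for a
    using Suc.prems(1)[of a] i(2) by (auto simp: inc_def)
  have "inc w i i \<noteq> x i" using Suc.prems(1)[of i] by (simp add: inc_def)
  then have neq: "inc w i \<noteq> x" by metis
  have "(\<Sum>a\<in>sites N. y a - w a) = (y i - w i) + (\<Sum>a\<in>sites N - {i}. y a - w a)"
    using i(1) by (intro sum.remove) auto
  moreover have "(\<Sum>a\<in>sites N. y a - inc w i a) = (y i - inc w i i) + (\<Sum>a\<in>sites N - {i}. y a - inc w i a)"
    using i(1) by (intro sum.remove) auto
  moreover have "(\<Sum>a\<in>sites N - {i}. y a - inc w i a) = (\<Sum>a\<in>sites N - {i}. y a - w a)"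
    by (intro sum.cong) (auto simp: inc_def)
  moreover have "inc w i i = w i + 1" by (simp add: inc_def)
  ultimately have "(\<Sum>a\<in>sites N. y a - inc w i a) = k"
    using i(2) Suc.prems(2) by linarith
  note IH = Suc.IH[OF bounds this]
  have "\<delta> * (\<delta> ^ k * \<eta>) \<le> (killed N \<beta> S ^^ n) (\<lambda>_. 1) w"
  proof (rule stay_step[OF assms(1) i(1) S[OF bounds neq]])
    show "\<delta> ^ k * \<eta> \<le> 1" using assms by (intro mult_le_one power_le_one) auto
  qed (use assms IH step[OF Suc.prems(1) i(1)] in auto)
  then show ?case by (simp add: mult.assoc)
qed

text \<open>Potentials are sums of three heights and hence differ by at most \<open>3 * K\<close>,
  so no weight exceeds that of \<open>i\<close> by more than the inverse of
  \<open>\<beta> ^ (3 * K)\<close>.\<close>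

lemma step_prob_lower:
  assumes "N \<ge> 3" "0 < \<beta>" "\<beta> < 1" "i \<in> sites N"
    and spread: "\<And>a b. a \<in> sites N \<Longrightarrow> b \<in> sites N \<Longrightarrow> w a \<le> w b + K"
  shows "\<beta> ^ (3 * K) / (real N + 1) \<le> step_prob N \<beta> w i"
proof -
  define W where "W = (\<Sum>j\<in>sites N. \<beta> ^ potential N w j)"
  have W: "W > 0" unfolding W_def by (rule weight_sum_pos[OF assms(2)])
  have "\<beta> ^ (3 * K) * W = (\<Sum>j\<in>sites N. \<beta> ^ (3 * K + potential N w j))"
    by (simp add: W_def sum_distrib_left power_add)
  also have "\<dots> \<le> (\<Sum>j\<in>sites N. \<beta> ^ potential N w i)"
  proof (intro sum_mono power_decreasing)
    fix j assume j: "j \<in> sites N"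
    show "potential N w i \<le> 3 * K + potential N w j"
      unfolding potential_eq[OF assms(1,4)] potential_eq[OF assms(1) j]
      using spread[OF prev_site_in[OF assms(4)] prev_site_in[OF j]] spread[OF assms(4) j]
        spread[OF next_site_in[OF assms(4)] next_site_in[OF j]] by linarith
  qed (use assms in auto)
  finally have "\<beta> ^ (3 * K) * W \<le> (real N + 1) * \<beta> ^ potential N w i" by (simp add: add.commute)
  then show ?thesis
    using W by (simp add: step_prob_def W_def[symmetric] divide_simps mult.commute)
qed

lemma differences_apply: "i \<in> {1..N} \<Longrightarrow> differences N x i = int (x i) - int (x (N + 1))"
  by (simp add: differences_def)

lemma differences_eqD:
  assumes "differences N w = differences N x" "j \<in> {1..N}" "w j = x j" "i \<in> sites N"
  shows "w i = x i"
proof -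
  have eq: "int (w i) - int (w (N + 1)) = int (x i) - int (x (N + 1))" if "i \<in> {1..N}" for i
    using fun_cong[OF assms(1), of i] unfolding differences_apply[OF that] .
  have last: "w (N + 1) = x (N + 1)" using eq[OF assms(2)] assms(3) by linarith
  show ?thesis
  proof (cases "i = N + 1")
    case False
    then have "i \<in> {1..N}" using assms(4) by (auto simp: sites_def)
    from eq[OF this] last show ?thesis by linarith
  qed (use last in simp)
qed

context growth_process
begin

text \<open>Adding \<open>m\<close> times \<open>tilt\<close> leads from every configuration in the
  class of \<open>z\<close> to a very low form, with a number of steps and step probabilities
  controlled by \<open>z\<close> alone. From there the class is avoided forever with probability at
  least \<open>1 - \<beta>\<close>, so the escape bound is uniform on the class.\<close>

lemma AE_leave_difference_class:
  assumes "N \<ge> 3" "0 < \<beta>" "\<beta> < 1"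
  shows "AE \<omega> in M. eventually (\<lambda>t. differences N (\<xi> t \<omega>) \<noteq> z) sequentially"
proof -
  define z' where "z' i = (if i \<in> {1..N} then real_of_int (z i) else 0)" for i
  obtain q where q: "\<And>x. form N (\<lambda>i. real (x i)) < q \<Longrightarrow>
      killed N \<beta> UNIV (\<lambda>y. \<beta> powr (- form N (\<lambda>i. real (y i)) / 2)) x \<le> \<beta> powr (- form N (\<lambda>i. real (x i)) / 2)"
    using form_powr_superharmonic[OF assms] by blast
  \<comment> \<open>The minimum keeps the class of \<open>z\<close> out of the region where the form
    is below \<open>q0\<close>, so that region lies in \<open>S\<close>.\<close>
  define q0 where "q0 = min q (form N z')"
  obtain m :: nat where m: "form N (\<lambda>i. z' i + real m * real (tilt i)) \<le> q0 - 2"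
    using form_tilt_unbounded[OF assms(1)] by blast
  define s where "s = nat (\<Sum>a\<in>{1..N}. \<bar>z a\<bar>)"
  \<comment> \<open>\<open>2 * s\<close> bounds the spread of heights within the class, and
    \<open>2 * m\<close> the growth along the path, since \<open>tilt\<close> is at most 2.\<close>
  define K where "K = 2 * s + 2 * m"
  define \<delta> where "\<delta> = \<beta> ^ (3 * K) / (real N + 1)"
  define k where "k = (\<Sum>a\<in>sites N. m * tilt a)"
  define S where "S = {w. differences N w \<noteq> z}"
  have "\<beta> ^ (3 * K) \<le> 1" using assms by (intro power_le_one) auto
  then have \<delta>: "0 < \<delta>" "\<delta> \<le> 1" using assms by (auto simp: \<delta>_def divide_le_eq)
  have shift: "real (w i) = z' i + real (w (N + 1))" if "differences N w = z" "i \<in> sites N" for w i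
  proof (cases "i = N + 1")
    case False
    then have i: "i \<in> {1..N}" using that by (auto simp: sites_def)
    have "z i = int (w i) - int (w (N + 1))" using differences_apply[OF i, of w] that(1) by simp
    then show ?thesis using i by (simp add: z'_def)
  qed (simp add: z'_def)
  have S: "w \<in> S" if "form N (\<lambda>i. real (w i)) < q0" for w
  proof (rule ccontr)
    assume "w \<notin> S"
    then have "form N (\<lambda>i. real (w i)) = form N (\<lambda>i. z' i + real (w (N + 1)))"
      using shift[of w] by (intro form_cong) (simp add: S_def)
    also have "\<dots> = form N z'" by (rule form_shift[OF assms(1)])
    finally show False using that by (simp add: q0_def)
  qed
  have escape: "\<delta> ^ k * (1 - \<beta>) \<le> (killed N \<beta> S ^^ n) (\<lambda>_. 1) x" if x: "differences N x = z" for x n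
  proof -
    define y where "y a = x a + (if a \<in> sites N then m * tilt a else 0)" for a
    have "form N (\<lambda>i. real (y i)) = form N (\<lambda>i. (z' i + real m * real (tilt i)) + real (x (N + 1)))"
      using shift[OF x] by (intro form_cong) (simp add: y_def)
    also have "\<dots> = form N (\<lambda>i. z' i + real m * real (tilt i))" by (rule form_shift[OF assms(1)])
    finally have y_low: "form N (\<lambda>i. real (y i)) \<le> q0 - 2" using m by simp
    have spread_x: "x a \<le> x b + 2 * s" if "a \<in> sites N" "b \<in> sites N" for a b
    proof -
      have "\<bar>int (x c) - int (x (N + 1))\<bar> \<le> int s" if "c \<in> sites N" for c
      proof (cases "c = N + 1")
        case False
        then have c: "c \<in> {1..N}" using that by (auto simp: sites_def)
        have "\<bar>z c\<bar> \<le> (\<Sum>a\<in>{1..N}. \<bar>z a\<bar>)" using c by (intro member_le_sum) auto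
        moreover have "z c = int (x c) - int (x (N + 1))" using differences_apply[OF c, of x] x by simp
        ultimately show ?thesis by (simp add: s_def)
      qed simp
      from this[OF that(1)] this[OF that(2)] show ?thesis by linarith
    qed
    show ?thesis
    proof (rule stay_along_path[of \<beta> \<delta> "1 - \<beta>" x y])
      fix w i assume w: "\<And>a. x a \<le> w a \<and> w a \<le> y a" and i: "i \<in> sites N"
      have "w a \<le> w b + K" if "a \<in> sites N" "b \<in> sites N" for a b
      proof -
        have "w a \<le> x a + m * tilt a" using w[of a] that(1) by (simp add: y_def)
        also have "m * tilt a \<le> m * 2" by (intro mult_left_mono) (auto simp: tilt_def)
        finally show ?thesis using spread_x[OF that] w[of b] unfolding K_def by linarith
      qed
      then show "\<delta> \<le> step_prob N \<beta> w i"
        unfolding \<delta>_def by (intro step_prob_lower assms i)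
    next
      fix w assume w: "\<And>a. x a \<le> w a \<and> w a \<le> y a" and neq: "w \<noteq> x"
      show "w \<in> S"
      proof (rule ccontr)
        assume "w \<notin> S"
        then have same: "differences N w = differences N x" using x by (simp add: S_def)
        \<comment> \<open>Site 2 never grows along the path, so a return to the class of
          \<open>z\<close> would have to be a return to \<open>x\<close> itself.\<close>
        have "tilt 2 = 0" by (simp add: tilt_def)
        then have w2: "w 2 = x 2" using w[of 2] by (simp add: y_def split: if_splits)
        have "2 \<in> {1..N}" using assms(1) by simp
        from differences_eqD[OF same this w2] have "w i = x i" if "i \<in> sites N" for i
          using that .
        moreover have "w i = x i" if "i \<notin> sites N" for i
          using w[of i] that by (simp add: y_def)
        ultimately show False using neq by blast
      qed
    next
      fix n
      show "1 - \<beta> \<le> (killed N \<beta> S ^^ n) (\<lambda>_. 1) y"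
        by (rule stay_low_form[OF assms q S y_low]) (simp_all add: q0_def)
    next
      show "(\<Sum>a\<in>sites N. y a - x a) = k" unfolding k_def by (intro sum.cong) (auto simp: y_def)
    qed (use assms \<delta> in \<open>auto simp: y_def\<close>)
  qed
  show ?thesis
  proof (rule AE_finite_occurrences[where \<epsilon>="\<delta> ^ k * (1 - \<beta>)" and B="\<lambda>t x. differences N (x t) = z"])
    show "differences N (x t) = z \<longleftrightarrow> differences N (y t) = z" if "\<And>s. s \<le> t \<Longrightarrow> x s = y s" for t :: nat and x y
      by (simp only: that[OF order_refl])
    show "\<exists>S. (\<forall>n. \<delta> ^ k * (1 - \<beta>) \<le> (killed N \<beta> S ^^ n) (\<lambda>_. 1) (x t)) \<and>
      (\<forall>y. (\<forall>s\<le>t. y s = x s) \<longrightarrow> (\<forall>s>t. y s \<in> S) \<longrightarrow> (\<forall>s>t. differences N (y s) \<noteq> z))"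
      if "differences N (x t) = z" for t and x
      using escape[OF that] by (intro exI[of _ S]) (simp add: S_def)
  qed (use assms \<delta> in auto)
qed

text \<open>A ball contains finitely many integer points, and almost surely each of them is avoided
  from some time on.\<close>

lemma transient_subcritical:
  assumes "N \<ge> 3" "0 < \<beta>" "\<beta> < 1"
  shows "transient M N (\<lambda>t \<omega>. differences N (\<xi> t \<omega>))"
proof -
  define Z where "Z = ({1..N} \<rightarrow>\<^sub>E UNIV :: (nat \<Rightarrow> int) set)"
  have "countable Z" unfolding Z_def by (intro countable_PiE) auto
  then have "AE \<omega> in M. \<forall>z\<in>Z. eventually (\<lambda>t. differences N (\<xi> t \<omega>) \<noteq> z) sequentially"
    using AE_leave_difference_class[OF assms] by (simp add: AE_ball_countable)
  then show ?thesis
    unfolding transient_def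
  proof eventually_elim
    case (elim \<omega>)
    show ?case
      unfolding filterlim_at_top
    proof
      fix R :: real
      let ?norm = "\<lambda>z. L2_set (\<lambda>i. real_of_int (z i)) {1..N}"
      define A where "A = {z \<in> Z. ?norm z < R}"
      have "A \<subseteq> {1..N} \<rightarrow>\<^sub>E {- \<lceil>R\<rceil>..\<lceil>R\<rceil>}"
      proof
        fix z assume z: "z \<in> A"
        have "z i \<in> {- \<lceil>R\<rceil>..\<lceil>R\<rceil>}" if "i \<in> {1..N}" for i
        proof -
          have "\<bar>real_of_int (z i)\<bar> \<le> L2_set (\<lambda>i. \<bar>real_of_int (z i)\<bar>) {1..N}"
            using that by (intro member_le_L2_set) auto
          also have "\<dots> = ?norm z" by (simp add: L2_set_def)
          also have "\<dots> < R" using z by (simp add: A_def)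
          finally show ?thesis by (auto simp: abs_less_iff) linarith+
        qed
        with z show "z \<in> {1..N} \<rightarrow>\<^sub>E {- \<lceil>R\<rceil>..\<lceil>R\<rceil>}" by (auto simp: A_def Z_def PiE_iff)
      qed
      then have "finite A" by (rule finite_subset) (auto intro: finite_PiE)
      moreover have "\<forall>z\<in>A. eventually (\<lambda>t. differences N (\<xi> t \<omega>) \<noteq> z) sequentially"
        using elim by (auto simp: A_def)
      ultimately have "eventually (\<lambda>t. \<forall>z\<in>A. differences N (\<xi> t \<omega>) \<noteq> z) sequentially"
        by (simp add: eventually_ball_finite)
      then show "eventually (\<lambda>t. R \<le> ?norm (differences N (\<xi> t \<omega>))) sequentially"
      proof eventually_elim
        case (elim t)
        have "differences N (\<xi> t \<omega>) \<in> Z" by (auto simp: Z_def differences_def)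
        with elim show ?case by (force simp: A_def not_less)
      qed
    qed
  qed
qed

end

section \<open>Transience from localisation, and the final assembly\<close>

lemma L2_at_top:
  fixes \<zeta> :: "nat \<Rightarrow> nat \<Rightarrow> int" and a :: "nat \<Rightarrow> nat"
  assumes "i \<in> {1..N}" "filterlim a at_top sequentially"
    and "eventually (\<lambda>t. int (a t) - c \<le> \<bar>\<zeta> t i\<bar>) sequentially"
  shows "filterlim (\<lambda>t. L2_set (\<lambda>i. real_of_int (\<zeta> t i)) {1..N}) at_top sequentially"
proof (rule filterlim_at_top_mono)
  have "filterlim (\<lambda>t. real (a t)) at_top sequentially"
    using assms(2) by (simp add: filterlim_sequentially_iff_filterlim_real)
  then show "filterlim (\<lambda>t. - real_of_int c + real (a t)) at_top sequentially"
    by (rule filterlim_tendsto_add_at_top[OF tendsto_const])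
  show "eventually (\<lambda>t. - real_of_int c + real (a t) \<le> L2_set (\<lambda>i. real_of_int (\<zeta> t i)) {1..N}) sequentially"
    using assms(3)
  proof eventually_elim
    case (elim t)
    have "real_of_int (int (a t) - c) \<le> \<bar>real_of_int (\<zeta> t i)\<bar>" using elim by linarith
    also have "\<dots> \<le> L2_set (\<lambda>i. \<bar>real_of_int (\<zeta> t i)\<bar>) {1..N}"
      using assms(1) by (intro member_le_L2_set) auto
    also have "\<dots> = L2_set (\<lambda>i. real_of_int (\<zeta> t i)) {1..N}" by (simp add: L2_set_def)
    finally show ?case by simp
  qed
qed

text \<open>If the reference site \<open>N + 1\<close> is frozen, the difference at \<open>k\<close>
  diverges. If it lies in the pair, a frozen site among the first \<open>N\<close>, which exists
  since the pair has only two sites, has a difference tending to minus infinity.\<close>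

lemma localised_norm_at_top:
  fixes x :: "nat \<Rightarrow> nat \<Rightarrow> nat"
  assumes "N \<ge> 3" "k \<in> sites N"
    and frozen: "\<And>s i. s \<ge> T \<Longrightarrow> i \<notin> {prev_site N k, k} \<Longrightarrow> x s i = x T i"
    and grow: "filterlim (\<lambda>t. x t k) at_top sequentially" "filterlim (\<lambda>t. x t (prev_site N k)) at_top sequentially"
  shows "filterlim (\<lambda>t. L2_set (\<lambda>i. real_of_int (differences N (x t) i)) {1..N}) at_top sequentially"
proof (cases "N + 1 \<in> {prev_site N k, k}")
  case False
  then have k: "k \<in> {1..N}" using assms(2) by (auto simp: sites_def)
  show ?thesis
  proof (rule L2_at_top[OF k grow(1)])
    show "eventually (\<lambda>t. int (x t k) - int (x T (N + 1)) \<le> \<bar>differences N (x t) k\<bar>) sequentially"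
      using eventually_ge_at_top[of T]
    proof eventually_elim
      case (elim t)
      show ?case using frozen[OF elim False] unfolding differences_apply[OF k] by linarith
    qed
  qed
next
  case True
  have "\<exists>i. i \<in> {1..N} \<and> i \<notin> {prev_site N k, k}"
  proof (rule ccontr)
    assume "\<not> ?thesis"
    then have "{1..N} \<subseteq> {prev_site N k, k}" by blast
    then have "card {1..N} \<le> card {prev_site N k, k}" by (intro card_mono) auto
    also have "\<dots> \<le> 2" by (simp add: card_insert_if)
    finally show False using assms(1) by simp
  qed
  then obtain i where i: "i \<in> {1..N}" "i \<notin> {prev_site N k, k}" by blast
  have "filterlim (\<lambda>t. x t (N + 1)) at_top sequentially"
    using True grow by auto
  then show ?thesis
  proof (rule L2_at_top[OF i(1)])
    show "eventually (\<lambda>t. int (x t (N + 1)) - int (x T i) \<le> \<bar>differences N (x t) i\<bar>) sequentially"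
      using eventually_ge_at_top[of T]
    proof eventually_elim
      case (elim t)
      show ?case using frozen[OF elim i(2)] unfolding differences_apply[OF i(1)] by linarith
    qed
  qed
qed

theorem theorem3:
  fixes M :: "'w measure" and N :: nat and \<beta> :: real
    and \<xi> :: "nat \<Rightarrow> 'w \<Rightarrow> nat \<Rightarrow> nat"
  assumes "N \<ge> 3" and "\<beta> \<in> {0<..<1} \<union> {1<..}"
    and "growth_process M N \<beta> \<xi>"
  shows "transient M N (\<lambda>t \<omega>. differences N (\<xi> t \<omega>)) \<and>
    (\<beta> > 1 \<longrightarrow> (AE \<omega> in M. \<exists>k\<in>{1..N + 1}.
      (\<forall>i\<in>{1..N + 1}. filterlim (\<lambda>t. \<xi> t \<omega> i) at_top sequentially \<longleftrightarrow> i \<in> {prev_site N k, k}) \<and>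
      (\<exists>c::int.
        (\<lambda>t. int (\<xi> t \<omega> (next_site N k)) - int (\<xi> t \<omega> (prev_site N (prev_site N k))))
          \<longlonglongrightarrow> c \<and>
        (\<lambda>t. real (\<xi> t \<omega> k) / real (\<xi> t \<omega> (prev_site N k))) \<longlonglongrightarrow> \<beta> powi c)))"
proof -
  interpret growth_process M N \<beta> \<xi> by (rule assms(3))
  show ?thesis
  proof (cases "\<beta> > 1")
    case False
    then show ?thesis using transient_subcritical[OF assms(1)] assms(2) by auto
  next
    case True
    note loc = AE_localised[OF assms(1) True]
    have "transient M N (\<lambda>t \<omega>. differences N (\<xi> t \<omega>))"
      unfolding transient_def using loc
    proof eventually_elim
      case (elim \<omega>)
      then show ?case using localised_norm_at_top[OF assms(1), of _ _ "\<lambda>t. \<xi> t \<omega>"] by blast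
    qed
    moreover have "AE \<omega> in M. \<exists>k\<in>{1..N + 1}.
      (\<forall>i\<in>{1..N + 1}. filterlim (\<lambda>t. \<xi> t \<omega> i) at_top sequentially \<longleftrightarrow> i \<in> {prev_site N k, k}) \<and>
      (\<exists>c::int.
        (\<lambda>t. int (\<xi> t \<omega> (next_site N k)) - int (\<xi> t \<omega> (prev_site N (prev_site N k))))
          \<longlonglongrightarrow> c \<and>
        (\<lambda>t. real (\<xi> t \<omega> k) / real (\<xi> t \<omega> (prev_site N k))) \<longlonglongrightarrow> \<beta> powi c)"
      using loc
    proof eventually_elim
      case (elim \<omega>)
      then obtain k T where k: "k \<in> sites N"
        and frozen: "\<And>s i. s \<ge> T \<Longrightarrow> i \<notin> {prev_site N k, k} \<Longrightarrow> \<xi> s \<omega> i = \<xi> T \<omega> i"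
        and grow: "filterlim (\<lambda>t. \<xi> t \<omega> k) at_top sequentially"
          "filterlim (\<lambda>t. \<xi> t \<omega> (prev_site N k)) at_top sequentially"
        and ratio: "(\<lambda>t. real (\<xi> t \<omega> k) / real (\<xi> t \<omega> (prev_site N k)))
          \<longlonglongrightarrow> \<beta> powi (int (\<xi> T \<omega> (next_site N k)) - int (\<xi> T \<omega> (prev_site N (prev_site N k))))"
        by blast
      have bounded: "\<not> filterlim (\<lambda>t. \<xi> t \<omega> i) at_top sequentially" if "i \<notin> {prev_site N k, k}" for i
      proof
        assume "filterlim (\<lambda>t. \<xi> t \<omega> i) at_top sequentially"
        then have "eventually (\<lambda>t. \<xi> t \<omega> i \<ge> \<xi> T \<omega> i + 1) sequentially"
          by (simp only: filterlim_at_top)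
        from eventually_conj[OF this eventually_ge_at_top[of T]]
        obtain t where "\<xi> t \<omega> i \<ge> \<xi> T \<omega> i + 1" "t \<ge> T"
          by (auto dest: eventually_happens)
        with frozen[OF this(2) that] show False by simp
      qed
      have off: "next_site N k \<notin> {prev_site N k, k}" "prev_site N (prev_site N k) \<notin> {prev_site N k, k}"
        using distinct_sites[OF assms(1) k] by auto
      \<comment> \<open>Both flanking sites are frozen, so this integer sequence is constant from
        \<open>T\<close> on, and its value is the exponent \<open>c\<close>.\<close>
      have "(\<lambda>t. int (\<xi> t \<omega> (next_site N k)) - int (\<xi> t \<omega> (prev_site N (prev_site N k))))
        \<longlonglongrightarrow> int (\<xi> T \<omega> (next_site N k)) - int (\<xi> T \<omega> (prev_site N (prev_site N k)))"
      proof (rule tendsto_eventually)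
        show "eventually (\<lambda>t. int (\<xi> t \<omega> (next_site N k)) - int (\<xi> t \<omega> (prev_site N (prev_site N k)))
          = int (\<xi> T \<omega> (next_site N k)) - int (\<xi> T \<omega> (prev_site N (prev_site N k)))) sequentially"
          using eventually_ge_at_top[of T]
        proof eventually_elim
          case (elim t)
          show ?case using frozen[OF elim off(1)] frozen[OF elim off(2)] by (simp only:)
        qed
      qed
      moreover have "filterlim (\<lambda>t. \<xi> t \<omega> i) at_top sequentially \<longleftrightarrow> i \<in> {prev_site N k, k}" for i
        using bounded[of i] grow by blast
      ultimately show ?case using k ratio unfolding sites_def by blast
    qed
    ultimately show ?thesis by blast
  qed
qed

end
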